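(* Set $t=q^{-1}$. For all permutations $w\in S_n$, $$\mathrm{stab}_-(w)=(-1)^{\ell(w_0)}q^{\ell(w_0)-\ell(w)/2}\,r(\boldsymbol{x}_{w_0};\boldsymbol{y})\,Z^\square_{1_W,w}(\boldsymbol{x}^{-1};\boldsymbol{y}^{-1})$$ and $$\mathrm{stab}_+(w)=q^{\ell(w_0)-\ell(w)/2}\,r(\boldsymbol{x};\boldsymbol{y}_{w_0})\,Z^\square_{w_0,w}(\boldsymbol{x}^{-1};\boldsymbol{y}_{w_0}^{-1}).$$
   Context: $W=S_n$, $1_W=e$ the identity, $s_i=(i,i+1)$, $w_0(i)=n+1-i$, $\ell$ the length, $<$ Bruhat order, products are compositions; $\boldsymbol{x}^{\alpha_i}=x_i/x_{i+1}$; $\boldsymbol{x}_{w_0}=(x_n,\dots,x_1)$, $\boldsymbol{y}_{w_0}=(y_n,\dots,y_1)$; $\boldsymbol{x}^{-1}=(x_1^{-1},\dots,x_n^{-1})$, $\boldsymbol{y}^{-1}$ and $\boldsymbol{y}_{w_0}^{-1}=(y_n^{-1},\dots,y_1^{-1})$ likewise; $q^{1/2}$ is an indeterminate. $s_i$ acts on functions of $(\boldsymbol{x};\boldsymbol{y})$ by exchanging $x_i,x_{i+1}$ (fixing $\boldsymbol{y}$). $r(\boldsymbol{x};\boldsymbol{y})=(-1)^{\ell(w_0)}\prod_{i=1}^n x_i^{n-i}y_i^{-(n-i)}$. Lifted K-theoretic stable envelopes: let $$M_i^+=\frac{q^{1/2}-q^{-1/2}}{1-\boldsymbol{x}^{\alpha_i}}-\frac{q^{-1/2}\boldsymbol{x}^{\alpha_i}-q^{1/2}}{1-\boldsymbol{x}^{-\alpha_i}}s_i,\qquad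 M_i^-=\frac{q^{-1/2}-q^{1/2}}{1-\boldsymbol{x}^{-\alpha_i}}+\frac{q^{-1/2}-q^{1/2}\boldsymbol{x}^{-\alpha_i}}{1-\boldsymbol{x}^{\alpha_i}}s_i$$ (both families satisfy the braid relations). They are determined by $\mathrm{stab}_+(e)=\prod_{i<j}(1-x_i/y_j)$ and $\mathrm{stab}_+(ws_i)=M_i^+\mathrm{stab}_+(w)$ if $ws_i>w$; and $\mathrm{stab}_-(w_0)=q^{\ell(w_0)/2}r(\boldsymbol{x}_{w_0};\boldsymbol{x})\prod_{i+j\le n}(1-x_i/y_j)$ and $\mathrm{stab}_-(ws_i)=M_i^-\mathrm{stab}_-(w)$ if $ws_i<w$. Lattice model ($\square=(n,n-1,\dots,1)$): an $n\times n$ square grid with rows numbered $1,\dots,n$ from top to bottom and columns numbered $1,\dots,n$ from right to left; the vertex in row $i$, column $j$ has parameters $x=x_i$, $y=y_j$. Horizontal edges carry a spin in $\{+,1,\dots,n\}$ ($+$ = uncolored), vertical edges carry a subset of the color set $\{1<\dots<n\}$. The weight of a vertex with left spin $L$, top spin $\Sigma$, right spin $L'$, bottom spin $\Sigma'$, written $(L,\Sigma;L',\Sigma')$, is zero unless listed ($\Sigma_{>c},\Sigma_{<c},\Sigma_{(c,d)}$ denote the elements of $\Sigma$ that are $>c$, $<c$, strictly between $c$ and $d$): (1) $(+,\Sigma;+,\Sigma)$: $(-t)^{|\Sigma|}$. (2) $(c,\Sigma;c,\Sigma)$: $t^{|\Sigma_{>c}|}(-xy^{-1}+t^{\delta})$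 with $\delta=1$ if $c\in\Sigma$, else $0$. (3) $(+,\Sigma;c,\Sigma\setminus\{c\})$, $c\in\Sigma$: $(-t)^{|\Sigma_{<c}|}t^{|\Sigma_{>c}|}$. (4) $(c,\Sigma;+,\Sigma\cup\{c\})$, $c\notin\Sigma$: $-(1-t)xy^{-1}(-t)^{|\Sigma_{>c}|}$. (5) $(c,\Sigma;d,(\Sigma\cup\{c\})\setminus\{d\})$, $c<d$, $d\in\Sigma$, $c\notin\Sigma$: $-(1-t)xy^{-1}(-t)^{|\Sigma_{(c,d)}|}t^{|\Sigma_{>d}|}$. (6) $(d,\Sigma;c,(\Sigma\cup\{d\})\setminus\{c\})$, $c<d$, $c\in\Sigma$, $d\notin\Sigma$: $-(1-t)(-1)^{|\Sigma_{(c,d)}|}t^{|\Sigma_{>d}|}$. $Z^\square_{\sigma,w}(\boldsymbol{x};\boldsymbol{y})$ is the partition function, i.e. the sum over all assignments of spins to interior edges of the product of the vertex weights, with boundary conditions: the top boundary edge in column $j$ carries the single color $\sigma(j)$; the right boundary edge in row $i$ has color $w(i)$; left and bottom boundary edges are uncolored. *)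

theory Defs
  imports "HOL-Combinatorics.Permutations" "HOL-Library.FuncSet"
begin

text \<open>
  Elements of $S_n$ are functions \<open>w\<close> with \<open>w permutes {1..n}\<close>, multiplied by composition.
  Alphabets $(x_1, \dots, x_n)$ are functions \<open>x :: nat \<Rightarrow> 'a\<close> into a field, of which only the
  values on \<open>{1..n}\<close> matter. Throughout, \<open>v\<close> stands for $q^{1/2}$.
\<close>

section \<open>The symmetric group\<close>

definition simple_refl :: "nat \<Rightarrow> nat \<Rightarrow> nat" where
  "simple_refl i = transpose i (i + 1)"

definition longest :: "nat \<Rightarrow> nat \<Rightarrow> nat" where
  "longest n i = (if i \<in> {1..n} then n + 1 - i else i)"

definition perm_length :: "nat \<Rightarrow> (nat \<Rightarrow> nat) \<Rightarrow> nat" where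
  "perm_length n w =
     (LEAST k. \<exists>ks. length ks = k \<and> set ks \<subseteq> {1..<n} \<and> w = foldr (\<circ>) (map simple_refl ks) id)"

definition bruhat_step :: "nat \<Rightarrow> (nat \<Rightarrow> nat) \<Rightarrow> (nat \<Rightarrow> nat) \<Rightarrow> bool" where
  "bruhat_step n u w \<longleftrightarrow>
     (\<exists>i j. 1 \<le> i \<and> i < j \<and> j \<le> n \<and> w = u \<circ> transpose i j) \<and> perm_length n u < perm_length n w"

definition bruhat_less :: "nat \<Rightarrow> (nat \<Rightarrow> nat) \<Rightarrow> (nat \<Rightarrow> nat) \<Rightarrow> bool" where
  "bruhat_less n = (bruhat_step n)\<^sup>+\<^sup>+"

section \<open>Stable envelopes\<close>

text \<open>
  Rational functions of \<open>(x; y)\<close> are represented by their values at the points where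
  all denominators occurring below are nonzero; this set of points is stable under the action of
  the simple reflections on \<open>x\<close>.
\<close>

definition generic :: "nat \<Rightarrow> (nat \<Rightarrow> 'a::field) \<Rightarrow> (nat \<Rightarrow> 'a) \<Rightarrow> bool" where
  "generic n x y \<longleftrightarrow>
     (\<forall>i\<in>{1..n}. x i \<noteq> 0 \<and> y i \<noteq> 0) \<and> inj_on x {1..n}"

definition root_mon :: "nat \<Rightarrow> (nat \<Rightarrow> 'a::field) \<Rightarrow> 'a" where
  "root_mon i x = x i / x (i + 1)"

definition M_plus ::
  "'a::field \<Rightarrow> nat \<Rightarrow> ((nat \<Rightarrow> 'a) \<Rightarrow> (nat \<Rightarrow> 'a) \<Rightarrow> 'a) \<Rightarrow> (nat \<Rightarrow> 'a) \<Rightarrow> (nat \<Rightarrow> 'a) \<Rightarrow> 'a" where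
  "M_plus v i f x y =
     (v - inverse v) / (1 - root_mon i x) * f x y
     - (inverse v * root_mon i x - v) / (1 - inverse (root_mon i x)) * f (x \<circ> simple_refl i) y"

definition M_minus ::
  "'a::field \<Rightarrow> nat \<Rightarrow> ((nat \<Rightarrow> 'a) \<Rightarrow> (nat \<Rightarrow> 'a) \<Rightarrow> 'a) \<Rightarrow> (nat \<Rightarrow> 'a) \<Rightarrow> (nat \<Rightarrow> 'a) \<Rightarrow> 'a" where
  "M_minus v i f x y =
     (inverse v - v) / (1 - inverse (root_mon i x)) * f x y
     + (inverse v - v * inverse (root_mon i x)) / (1 - root_mon i x) * f (x \<circ> simple_refl i) y"

definition r_factor :: "nat \<Rightarrow> (nat \<Rightarrow> 'a::field) \<Rightarrow> (nat \<Rightarrow> 'a) \<Rightarrow> 'a" where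
  "r_factor n x y =
     (-1) ^ perm_length n (longest n) * (\<Prod>i=1..n. x i ^ (n - i) * y i powi (- int (n - i)))"

definition is_stab_plus ::
  "nat \<Rightarrow> 'a::field \<Rightarrow> ((nat \<Rightarrow> nat) \<Rightarrow> (nat \<Rightarrow> 'a) \<Rightarrow> (nat \<Rightarrow> 'a) \<Rightarrow> 'a) \<Rightarrow> bool" where
  "is_stab_plus n v S \<longleftrightarrow>
     (\<forall>x y. generic n x y \<longrightarrow>
        S id x y = (\<Prod>(i, j) | 1 \<le> i \<and> i < j \<and> j \<le> n. 1 - x i / y j)) \<and>
     (\<forall>w i. w permutes {1..n} \<longrightarrow> i \<in> {1..<n} \<longrightarrow> bruhat_less n w (w \<circ> simple_refl i) \<longrightarrow>
        (\<forall>x y. generic n x y \<longrightarrow> S (w \<circ> simple_refl i) x y = M_plus v i (S w) x y))"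

definition is_stab_minus ::
  "nat \<Rightarrow> 'a::field \<Rightarrow> ((nat \<Rightarrow> nat) \<Rightarrow> (nat \<Rightarrow> 'a) \<Rightarrow> (nat \<Rightarrow> 'a) \<Rightarrow> 'a) \<Rightarrow> bool" where
  "is_stab_minus n v S \<longleftrightarrow>
     (\<forall>x y. generic n x y \<longrightarrow>
        S (longest n) x y =
          v ^ perm_length n (longest n) * r_factor n (x \<circ> longest n) x
          * (\<Prod>(i, j) | 1 \<le> i \<and> 1 \<le> j \<and> i + j \<le> n. 1 - x i / y j)) \<and>
     (\<forall>w i. w permutes {1..n} \<longrightarrow> i \<in> {1..<n} \<longrightarrow> bruhat_less n (w \<circ> simple_refl i) w \<longrightarrow>
        (\<forall>x y. generic n x y \<longrightarrow> S (w \<circ> simple_refl i) x y = M_minus v i (S w) x y))"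

text \<open>
  For \<open>v \<noteq> 0\<close> families satisfying these recursions exist by the braid relations, and
  their values at permutations and generic points are uniquely determined because every permutation
  has a reduced word; hence the choice operator is harmless at the arguments of interest.
\<close>

definition stab_plus ::
  "nat \<Rightarrow> 'a::field \<Rightarrow> (nat \<Rightarrow> nat) \<Rightarrow> (nat \<Rightarrow> 'a) \<Rightarrow> (nat \<Rightarrow> 'a) \<Rightarrow> 'a" where
  "stab_plus n v = (SOME S. is_stab_plus n v S)"

definition stab_minus ::
  "nat \<Rightarrow> 'a::field \<Rightarrow> (nat \<Rightarrow> nat) \<Rightarrow> (nat \<Rightarrow> 'a) \<Rightarrow> (nat \<Rightarrow> 'a) \<Rightarrow> 'a" where
  "stab_minus n v = (SOME S. is_stab_minus n v S)"

section \<open>The lattice model\<close>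

text \<open>
  A horizontal spin is \<open>None\<close> (the uncolored spin $+$) or \<open>Some c\<close>; a vertical spin is a set of
  colors. The arguments of \<open>weight\<close> after \<open>t x y\<close> are the left, top, right and bottom spins.
\<close>

fun weight :: "'a::field \<Rightarrow> 'a \<Rightarrow> 'a \<Rightarrow> nat option \<Rightarrow> nat set \<Rightarrow> nat option \<Rightarrow> nat set \<Rightarrow> 'a" where
  "weight t x y None T None B =
     (if B = T then (- t) ^ card T else 0)"
| "weight t x y None T (Some c) B =
     (if c \<in> T \<and> B = T - {c}
      then (- t) ^ card {e \<in> T. e < c} * t ^ card {e \<in> T. c < e} else 0)"
| "weight t x y (Some c) T None B =
     (if c \<notin> T \<and> B = T \<union> {c}
      then - (1 - t) * (x * inverse y) * (- t) ^ card {e \<in> T. c < e} else 0)"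
| "weight t x y (Some a) T (Some b) B =
     (if a = b then
        (if B = T
         then t ^ card {e \<in> T. a < e} * (- (x * inverse y) + t ^ (if a \<in> T then 1 else 0)) else 0)
      else if a \<notin> T \<and> b \<in> T \<and> B = (T \<union> {a}) - {b} then
        (if a < b
         then - (1 - t) * (x * inverse y) * (- t) ^ card {e \<in> T. a < e \<and> e < b}
              * t ^ card {e \<in> T. b < e}
         else - (1 - t) * (- 1) ^ card {e \<in> T. b < e \<and> e < a} * t ^ card {e \<in> T. a < e})
      else 0)"

text \<open>
  Columns are numbered from right to left. The vertex in row \<open>i\<close>, column \<open>j\<close> has left edge
  \<open>hspin n w h i j\<close>, right edge \<open>hspin n w h i (j - 1)\<close>, top edge \<open>vspin n \<sigma> u (i - 1) j\<close> and
  bottom edge \<open>vspin n \<sigma> u i j\<close>. The functions \<open>h\<close> and \<open>u\<close> assign spins to the interior edges;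
  \<open>hspin\<close> and \<open>vspin\<close> extend them by the boundary conditions.
\<close>

definition hspin ::
  "nat \<Rightarrow> (nat \<Rightarrow> nat) \<Rightarrow> (nat \<times> nat \<Rightarrow> nat option) \<Rightarrow> nat \<Rightarrow> nat \<Rightarrow> nat option" where
  "hspin n w h i j = (if j = 0 then Some (w i) else if j = n then None else h (i, j))"

definition vspin ::
  "nat \<Rightarrow> (nat \<Rightarrow> nat) \<Rightarrow> (nat \<times> nat \<Rightarrow> nat set) \<Rightarrow> nat \<Rightarrow> nat \<Rightarrow> nat set" where
  "vspin n \<sigma> u i j = (if i = 0 then {\<sigma> j} else if i = n then {} else u (i, j))"

definition partition_fun ::
  "nat \<Rightarrow> 'a::field \<Rightarrow> (nat \<Rightarrow> nat) \<Rightarrow> (nat \<Rightarrow> nat) \<Rightarrow> (nat \<Rightarrow> 'a) \<Rightarrow> (nat \<Rightarrow> 'a) \<Rightarrow> 'a" where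
  "partition_fun n t \<sigma> w x y =
     (\<Sum>h \<in> ({1..n} \<times> {1..<n}) \<rightarrow>\<^sub>E insert None (Some ` {1..n}).
      \<Sum>u \<in> ({1..<n} \<times> {1..n}) \<rightarrow>\<^sub>E Pow {1..n}.
        \<Prod>i=1..n. \<Prod>j=1..n.
          weight t (x i) (y j)
            (hspin n w h i j) (vspin n \<sigma> u (i - 1) j)
            (hspin n w h i (j - 1)) (vspin n \<sigma> u i j))"

end

theory Submission
  imports Defs
begin

text \<open>
  Each of the two families of stable envelopes is pinned down by one initial value and a recursion
  along the simple reflections. The theorem therefore follows once the partition functions, with their
  monomial prefactors, are seen to satisfy the same initial condition and the same recursion. This
  also shows that such families exist, so that the choice in the definition of the envelopes
  is meaningful; uniqueness is an induction along chains of ascents or descents.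

  The recursion comes from a Yang--Baxter argument. Two adjacent rows with parameters \<open>X\<close> and \<open>Y\<close> can
  be exchanged at the cost of an R-matrix, which either keeps the two horizontal spins in place
  (coefficient \<open>R_stay\<close>) or interchanges them (coefficient \<open>R_swap\<close>). For a single column this is an
  identity between products of two vertex weights (\<open>column_exchanges\<close>). The vertical spin may contain
  any number of colors, but a color that differs from the four horizontal spins contributes a
  factor of rank one in the left and right spin (\<open>vertex_spectators\<close>), hence the same factor to every
  term. What remains is an identity with at most four colors, which is checked order type by
  order type (\<open>exchanges_few_colors\<close>). Columns can then be passed one after the other
  (\<open>two_row_sum_exchange\<close>). At the left boundary both spins are uncolored and the R-matrix is
  the scalar \<open>X - t * Y\<close>; at the right boundary it acts on the colors \<open>w i\<close> and \<open>w (i + 1)\<close>. The result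
  is a linear relation between the partition functions for \<open>w\<close> and \<open>w \<circ> simple_refl i\<close>
  (\<open>partition_fun_exchange\<close>), and with \<open>t = 1 / v\<^sup>2\<close> and inverted parameters this relation is the
  recursion given by \<open>M_plus\<close> when \<open>w i < w (i + 1)\<close> and by \<open>M_minus\<close> when \<open>w (i + 1) < w i\<close>.

  The initial values are frozen: for right boundary \<open>\<sigma> \<circ> longest n\<close> only one state has nonzero weight.
  In it the color entering column \<open>n + 1 - i\<close> turns right in row \<open>i\<close> and leaves straight through the
  columns \<open>j\<close> with \<open>i + j \<le> n\<close>, where it crosses the color \<open>\<sigma> j\<close>
  (\<open>partition_fun_frozen\<close>).
\<close>

section \<open>Vertex weights and spectator colors\<close>

text \<open>
  Conservation of color leaves at most one bottom spin of nonzero weight for given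
  left, top and right spins. Working with weights at that forced bottom spin removes the sums over
  interior vertical spins.
\<close>

definition bottom_spin :: "nat option \<Rightarrow> nat set \<Rightarrow> nat option \<Rightarrow> nat set" where
  "bottom_spin L T R = (if L = R then T else (T \<union> set_option L) - set_option R)"

fun vertex :: "'a::field \<Rightarrow> 'a \<Rightarrow> nat option \<Rightarrow> nat set \<Rightarrow> nat option \<Rightarrow> 'a" where
  "vertex t X None T None = (- t) ^ card T"
| "vertex t X None T (Some c) =
     (if c \<in> T then (- t) ^ card {e \<in> T. e < c} * t ^ card {e \<in> T. c < e} else 0)"
| "vertex t X (Some c) T None = (if c \<in> T then 0 else - (1 - t) * X * (- t) ^ card {e \<in> T. c < e})"
| "vertex t X (Some a) T (Some b) =
     (if a = b then t ^ card {e \<in> T. a < e} * (- X + (if a \<in> T then t else 1))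
      else if a \<in> T \<or> b \<notin> T then 0
      else if a < b
        then - (1 - t) * X * (- t) ^ card {e \<in> T. a < e \<and> e < b} * t ^ card {e \<in> T. b < e}
        else - (1 - t) * (- 1) ^ card {e \<in> T. b < e \<and> e < a} * t ^ card {e \<in> T. a < e})"

lemma weight_eq_vertex:
  "weight t x y L T R B = (if B = bottom_spin L T R then vertex t (x * inverse y) L T R else 0)"
  by (cases L; cases R) (auto simp: bottom_spin_def)

text \<open>
  The factor contributed by a vertical color \<open>e\<close> that passes through a vertex whose horizontal
  spins are different from \<open>e\<close>. It is the product of a function of the left spin and a function of the
  right spin; therefore \<open>spectator t a c e * spectator t b d e\<close> does not change when \<open>a\<close> and \<open>b\<close>,
  or \<open>c\<close> and \<open>d\<close>, are interchanged. The uncolored spin behaves like a color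
  below \<open>e\<close> except for a sign on the right.
\<close>

definition spectator :: "'a::field \<Rightarrow> nat option \<Rightarrow> nat option \<Rightarrow> nat \<Rightarrow> 'a" where
  "spectator t L R e = (case L of None \<Rightarrow> t | Some c \<Rightarrow> if c < e then t else - 1) *
     (case R of None \<Rightarrow> - 1 | Some c \<Rightarrow> if c < e then 1 else - 1)"

lemma vertex_spectator:
  assumes "finite T" "e \<notin> T" "e \<notin> set_option L" "e \<notin> set_option R"
  shows "vertex t X L (insert e T) R = spectator t L R e * vertex t X L T R"
proof -
  have c: "card {f. (f = e \<or> f \<in> T) \<and> P f}
      = (if P e then Suc (card {f \<in> T. P f}) else card {f \<in> T. P f})" for P
  proof -
    have "{f. (f = e \<or> f \<in> T) \<and> P f} = (if P e then insert e {f \<in> T. P f} else {f \<in> T. P f})"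
      by auto
    then show ?thesis using assms(1,2) by simp
  qed
  show ?thesis
    using assms by (cases L; cases R) (simp_all add: spectator_def c)
qed

lemma vertex_spectators:
  assumes "finite D" "finite T" "D \<inter> T = {}" "D \<inter> set_option L = {}" "D \<inter> set_option R = {}"
  shows "vertex t X L (D \<union> T) R = (\<Prod>e\<in>D. spectator t L R e) * vertex t X L T R"
  using assms
proof (induction D)
  case (insert e D)
  then show ?case
    using vertex_spectator[of "D \<union> T" e L R t X] by auto
qed simp

lemma vertex_eq_0_left: "a \<in> T \<Longrightarrow> R \<noteq> Some a \<Longrightarrow> vertex t X (Some a) T R = 0"
  by (cases R) auto

lemma vertex_eq_0_right: "a \<notin> T \<Longrightarrow> L \<noteq> Some a \<Longrightarrow> vertex t X L T (Some a) = 0"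
  by (cases L) auto

section \<open>The exchange relation for a column\<close>

text \<open>
  Two vertices on top of each other, with left spins \<open>a\<close>, \<open>b\<close> and right spins \<open>c\<close>, \<open>d\<close> from top to
  bottom, and with the vertical spin between them summed out.
\<close>

definition column_weight :: "'a::field \<Rightarrow> 'a \<Rightarrow> 'a \<Rightarrow> nat option \<Rightarrow> nat option \<Rightarrow> nat option \<Rightarrow> nat option
    \<Rightarrow> nat set \<Rightarrow> nat set \<Rightarrow> 'a" where
  "column_weight t X Y a b c d T B = (if B = bottom_spin b (bottom_spin a T c) d
     then vertex t X a T c * vertex t Y b (bottom_spin a T c) d else 0)"

text \<open>
  Diagonal entries of the R-matrix for horizontal spins in two rows with parameters \<open>X\<close> and \<open>Y\<close>.
  The entries between two different colors are, up to scale, forced by the operators that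
  define the stable envelopes; the exchange relation below then determines
  the others.
\<close>

definition R_stay :: "'a::field \<Rightarrow> 'a \<Rightarrow> 'a \<Rightarrow> nat option \<Rightarrow> nat option \<Rightarrow> 'a" where
  "R_stay t X Y a b = (case (a, b) of
      (None, None) \<Rightarrow> X - t * Y
    | (None, Some _) \<Rightarrow> (1 - t) * Y
    | (Some _, None) \<Rightarrow> (1 - t) * X
    | (Some c, Some d) \<Rightarrow> if c = d then Y - t * X else if c < d then (1 - t) * X else (1 - t) * Y)"

definition R_swap :: "'a::field \<Rightarrow> 'a \<Rightarrow> 'a \<Rightarrow> nat option \<Rightarrow> nat option \<Rightarrow> 'a" where
  "R_swap t X Y a b = (case (a, b) of
      (None, None) \<Rightarrow> 0
    | (None, Some _) \<Rightarrow> - t * (X - Y)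
    | (Some _, None) \<Rightarrow> - (X - Y)
    | (Some c, Some d) \<Rightarrow> if c = d then 0 else if c < d then - t * (X - Y) else - (X - Y))"

text \<open>
  The Yang--Baxter equation for one column: the R-matrix applied to the left spins of the
  column with exchanged rows equals the R-matrix applied to the right spins of the original column.
  The variable \<open>i\<close> is the inverse of the column parameter.
\<close>

definition exchanges :: "'a::field \<Rightarrow> 'a \<Rightarrow> 'a \<Rightarrow> 'a \<Rightarrow> nat option \<Rightarrow> nat option \<Rightarrow> nat option
    \<Rightarrow> nat option \<Rightarrow> nat set \<Rightarrow> nat set \<Rightarrow> bool" where
  "exchanges t x1 x2 i a b c d T B \<longleftrightarrow>
     R_stay t x1 x2 a b * column_weight t (x2 * i) (x1 * i) a b c d T B
     + R_swap t x1 x2 b a * column_weight t (x2 * i) (x1 * i) b a c d T B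
   = column_weight t (x1 * i) (x2 * i) a b c d T B * R_stay t x1 x2 c d
     + column_weight t (x1 * i) (x2 * i) a b d c T B * R_swap t x1 x2 c d"

lemma Collect_insert_filter:
  "{f. (f = e \<or> Q f) \<and> P f} = (if P e then insert e {f. Q f \<and> P f} else {f. Q f \<and> P f})"
  by auto

lemma Collect_single_filter: "{f. f = e \<and> P f} = (if P e then {e} else {})"
  by auto

text \<open>
  When the vertical spin consists only of colors that also occur horizontally, there are
  finitely many cases: the relative order of at most four colors and the subset \<open>T\<close>. In each of them
  the equation is a polynomial identity. Color conservation makes most cases trivial.
\<close>

lemma exchanges_few_colors:
  assumes "T \<in> Pow (set_option a \<union> set_option b \<union> set_option c \<union> set_option d)"
  shows "exchanges t x1 x2 i a b c d T B"
proof -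
  have tri: "\<forall>p\<in>set_option k. \<forall>q\<in>set_option l. p < q \<or> p = q \<or> q < p" for k l :: "nat option"
    by (auto simp: not_less_iff_gr_or_eq)
  note orders = tri[of a b] tri[of a c] tri[of a d] tri[of b c] tri[of b d] tri[of c d]
  show ?thesis
    using assms orders
    \<comment> \<open>split by uncolored or colored spins, by order type and by \<open>T\<close>; the leading dash keeps
      the facts from being inserted again at every stage\<close>
    by - (cases a; cases b; cases c; cases d; hypsubst_thin;
       (simp only: option.set Un_insert_left Un_insert_right Un_empty_left Un_empty_right ball_simps simp_thms)?;
       (elim disjE)?; (hypsubst_thin+)?;
       (order | succeed);
       (simp only: Pow_insert Pow_empty image_insert image_empty Un_insert_left Un_empty_left
          Un_empty_right insert_iff empty_iff simp_thms insert_absorb2)?;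
       (elim disjE)?; (hypsubst_thin+)?;
       (simp add: exchanges_def column_weight_def bottom_spin_def vertex_eq_0_left vertex_eq_0_right insert_Diff_if
          insert_commute Collect_insert_filter Collect_single_filter R_stay_def R_swap_def)?;
       (simp add: algebra_simps)?)
qed

lemma column_weight_spectators:
  assumes "finite D" "finite T" "D \<inter> T = {}"
    and "D \<inter> (set_option a \<union> set_option b \<union> set_option c \<union> set_option d) = {}"
  shows "column_weight t X Y a b c d (D \<union> T) B
    = (if D \<subseteq> B then (\<Prod>e\<in>D. spectator t a c e * spectator t b d e) * column_weight t X Y a b c d T (B - D) else 0)"
proof -
  have o: "bottom_spin L (D \<union> T) R = D \<union> bottom_spin L T R" if "D \<inter> set_option R = {}" for L R T
    using that by (auto simp: bottom_spin_def)
  have o2: "D \<inter> bottom_spin L T R = {}" if "D \<inter> T = {}" "D \<inter> set_option L = {}" for L T R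
    using that by (auto simp: bottom_spin_def)
  have f: "finite (bottom_spin a T c)" using assms by (auto simp: bottom_spin_def)
  have r: "D \<inter> set_option a = {}" "D \<inter> set_option b = {}" "D \<inter> set_option c = {}" "D \<inter> set_option d = {}"
    using assms by auto
  have "bottom_spin b (bottom_spin a (D \<union> T) c) d = D \<union> bottom_spin b (bottom_spin a T c) d"
    using r by (simp add: o)
  moreover have "D \<inter> bottom_spin b (bottom_spin a T c) d = {}"
    using r assms by (simp add: o2)
  moreover have "vertex t X a (D \<union> T) c = (\<Prod>e\<in>D. spectator t a c e) * vertex t X a T c"
    using r assms by (intro vertex_spectators) auto
  moreover have "vertex t Y b (D \<union> bottom_spin a T c) d = (\<Prod>e\<in>D. spectator t b d e) * vertex t Y b (bottom_spin a T c) d"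
    using r assms f o2[of T a c] by (intro vertex_spectators) auto
  moreover have "(B = D \<union> G) = (D \<subseteq> B \<and> B - D = G)" if "D \<inter> G = {}" for G
    using that by auto
  ultimately show ?thesis
    using r by (simp add: column_weight_def o prod.distrib)
qed

text \<open>
  Spectator colors multiply all four terms of the equation by the same factor,
  by the rank-one form of \<open>spectator\<close>, so the case of few colors suffices.
\<close>

lemma column_exchanges:
  assumes "finite T"
  shows "exchanges t x1 x2 i a b c d T B"
proof -
  let ?Lt = "set_option a \<union> set_option b \<union> set_option c \<union> set_option d"
  \<comment> \<open>\<open>D\<close> collects the spectators\<close>
  define D F where "D = T - ?Lt" and "F = T \<inter> ?Lt"
  have T: "T = D \<union> F" by (auto simp: D_def F_def)
  have D: "finite D" "finite F" "D \<inter> F = {}" "D \<inter> ?Lt = {}"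
    using assms by (auto simp: D_def F_def)
  have core: "exchanges t x1 x2 i a b c d F (B - D)"
    by (rule exchanges_few_colors) (auto simp: F_def)
  let ?s = "\<Prod>e\<in>D. spectator t a c e * spectator t b d e"
  have s: "(\<Prod>e\<in>D. spectator t b c e * spectator t a d e) = ?s" "(\<Prod>e\<in>D. spectator t a d e * spectator t b c e) = ?s"
    by (simp_all add: spectator_def mult_ac)
  show ?thesis
  proof (cases "D \<subseteq> B")
    case True
    have sp: "column_weight t X Y a b c d T B = ?s * column_weight t X Y a b c d F (B - D)"
      "column_weight t X Y b a c d T B = ?s * column_weight t X Y b a c d F (B - D)"
      "column_weight t X Y a b d c T B = ?s * column_weight t X Y a b d c F (B - D)" for X Y
      unfolding T using True D s by (subst column_weight_spectators; force)+
    have "?s * (R_stay t x1 x2 a b * column_weight t (x2 * i) (x1 * i) a b c d F (B - D)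
        + R_swap t x1 x2 b a * column_weight t (x2 * i) (x1 * i) b a c d F (B - D))
      = ?s * (column_weight t (x1 * i) (x2 * i) a b c d F (B - D) * R_stay t x1 x2 c d
        + column_weight t (x1 * i) (x2 * i) a b d c F (B - D) * R_swap t x1 x2 c d)"
      using core unfolding exchanges_def by (rule arg_cong)
    then show ?thesis unfolding exchanges_def sp by (simp only: distrib_left mult_ac)
  next
    case False
    then have sp: "column_weight t X Y a' b' c' d' T B = 0"
      if "set_option a' \<union> set_option b' \<union> set_option c' \<union> set_option d' = ?Lt" for X Y a' b' c' d'
      unfolding T using D that by (subst column_weight_spectators) auto
    show ?thesis unfolding exchanges_def by (subst sp, blast)+ simp
  qed
qed

section \<open>Sums over interior states as transfer matrix products\<close>

text \<open>
  The matrix product \<open>f 1 \<cdots> f k\<close> with index set \<open>S\<close>, written out as a recursion. It serves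
  both for the edges within a row, counted from the right, and for the rows of the lattice,
  counted from the top.
\<close>

fun path_sum :: "'s set \<Rightarrow> (nat \<Rightarrow> 's \<Rightarrow> 's \<Rightarrow> 'a::comm_ring_1) \<Rightarrow> 's \<Rightarrow> nat \<Rightarrow> 's \<Rightarrow> 'a" where
  "path_sum S f a 0 b = (if a = b then 1 else 0)"
| "path_sum S f a (Suc k) b = (\<Sum>m\<in>S. path_sum S f a k m * f (Suc k) m b)"

lemma path_sum_cong:
  assumes "\<And>j m l. j \<in> {1..k} \<Longrightarrow> f j m l = g j m l"
  shows "path_sum S f a k b = path_sum S g a k b"
  using assms by (induction k arbitrary: b) (auto intro!: sum.cong)

lemma sum_PiE_insert:
  assumes "k \<notin> I"
  shows "(\<Sum>h\<in>insert k I \<rightarrow>\<^sub>E S. F h) = (\<Sum>h\<in>I \<rightarrow>\<^sub>E S. \<Sum>m\<in>S. F (h(k := m)))"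
proof -
  have "(\<Sum>h\<in>insert k I \<rightarrow>\<^sub>E S. F h) = (\<Sum>z\<in>S \<times> (I \<rightarrow>\<^sub>E S). F ((\<lambda>(y, g). g(k := y)) z))"
    unfolding PiE_insert_eq
    by (subst sum.reindex) (use inj_combinator[OF assms, of "\<lambda>_. S"] in \<open>simp_all add: o_def\<close>)
  also have "\<dots> = (\<Sum>m\<in>S. \<Sum>h\<in>I \<rightarrow>\<^sub>E S. F (h(k := m)))"
    by (simp add: sum.cartesian_product split_def)
  finally show ?thesis by (subst (asm) sum.swap)
qed

definition with_ends :: "'s \<Rightarrow> 's \<Rightarrow> nat \<Rightarrow> (nat \<Rightarrow> 's) \<Rightarrow> nat \<Rightarrow> 's" where
  "with_ends a b n h j = (if j = 0 then a else if j = n then b else h j)"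

lemma sum_interior_eq_path_sum:
  assumes "0 < n" "a \<in> S" "finite S"
  shows "(\<Sum>h\<in>{1..<n} \<rightarrow>\<^sub>E S. \<Prod>j=1..n. f j (with_ends a b n h (j - 1)) (with_ends a b n h j))
    = path_sum S f a n b"
  using assms(1)
proof (induction n arbitrary: b rule: nat_induct_non_zero)
  case 1
  have "(\<Sum>m\<in>S. (if a = m then 1 else 0) * f 1 m b) = f 1 a b"
    using assms by (subst sum.mono_neutral_right[of _ "{a}"]) auto
  then show ?case by (simp add: with_ends_def)
next
  case (Suc k)
  have *: "(\<Prod>j=1..Suc k. f j (with_ends a b (Suc k) (h(k := m)) (j - 1)) (with_ends a b (Suc k) (h(k := m)) j))
    = (\<Prod>j=1..k. f j (with_ends a m k h (j - 1)) (with_ends a m k h j)) * f (Suc k) m b" for h m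
  proof -
    have "(\<Prod>j=1..k. f j (with_ends a b (Suc k) (h(k := m)) (j - 1)) (with_ends a b (Suc k) (h(k := m)) j))
      = (\<Prod>j=1..k. f j (with_ends a m k h (j - 1)) (with_ends a m k h j))"
      by (rule prod.cong) (auto simp: with_ends_def)
    then show ?thesis using \<open>k > 0\<close> by (simp add: with_ends_def)
  qed
  have "{1..<Suc k} = insert k {1..<k}" using \<open>k > 0\<close> by auto
  then have "(\<Sum>h\<in>{1..<Suc k} \<rightarrow>\<^sub>E S. \<Prod>j=1..Suc k. f j (with_ends a b (Suc k) h (j - 1)) (with_ends a b (Suc k) h j))
    = (\<Sum>m\<in>S. \<Sum>h\<in>{1..<k} \<rightarrow>\<^sub>E S.
        (\<Prod>j=1..k. f j (with_ends a m k h (j - 1)) (with_ends a m k h j)) * f (Suc k) m b)"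
    by (simp only: sum_PiE_insert atLeastLessThan_iff less_irrefl simp_thms * sum.swap[of _ S])
  also have "\<dots> = path_sum S f a (Suc k) b"
    by (simp only: path_sum.simps Suc.IH sum_distrib_right[symmetric])
  finally show ?case .
qed

text \<open>
  Configurations on a grid are families of configurations on its lines; this lets the sum over all
  interior edges be carried out row by row.
\<close>

lemma sum_PiE_curry:
  "(\<Sum>h\<in>A \<times> B \<rightarrow>\<^sub>E C. G (\<lambda>i\<in>A. \<lambda>j\<in>B. h (i, j))) = (\<Sum>g\<in>A \<rightarrow>\<^sub>E (B \<rightarrow>\<^sub>E C). G g)"
proof (rule sum.reindex_bij_witness)
  show "(\<lambda>i\<in>A. \<lambda>j\<in>B. (\<lambda>(i, j)\<in>A \<times> B. g i j) (i, j)) = g" if "g \<in> A \<rightarrow>\<^sub>E (B \<rightarrow>\<^sub>E C)" for g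
  proof (rule ext)+
    fix i j
    show "(\<lambda>i\<in>A. \<lambda>j\<in>B. (\<lambda>(i, j)\<in>A \<times> B. g i j) (i, j)) i j = g i j"
      using that by (cases "i \<in> A"; cases "j \<in> B") (auto simp: PiE_iff extensional_def)
  qed
  show "(\<lambda>(i, j)\<in>A \<times> B. (\<lambda>i\<in>A. \<lambda>j\<in>B. h (i, j)) i j) = h" if "h \<in> A \<times> B \<rightarrow>\<^sub>E C" for h
    using that by (force simp: PiE_iff extensional_def)
  show "G (\<lambda>i\<in>A. \<lambda>j\<in>B. h (i, j)) = G (\<lambda>i\<in>A. \<lambda>j\<in>B. h (i, j))" for h
    by (rule refl)
qed (auto simp: PiE_iff extensional_def)

text \<open>
  The weight of a row summed over its horizontal edges, restricted to the columns \<open>1, \<dots>, k\<close> with spin \<open>l\<close>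
  entering from the left; the restriction makes induction on the number of columns possible.
\<close>

definition row_sum :: "nat \<Rightarrow> 'a::field \<Rightarrow> (nat \<Rightarrow> 'a) \<Rightarrow> 'a \<Rightarrow> nat option
    \<Rightarrow> (nat \<Rightarrow> nat set) \<Rightarrow> (nat \<Rightarrow> nat set) \<Rightarrow> nat \<Rightarrow> nat option \<Rightarrow> 'a" where
  "row_sum n t y x c U U' k l =
     path_sum (insert None (Some ` {1..n})) (\<lambda>j m l. weight t x (y j) l (U j) m (U' j)) c k l"

lemma row_sum_cong:
  assumes "\<And>j. j \<in> {1..k} \<Longrightarrow> U j = V j" "\<And>j. j \<in> {1..k} \<Longrightarrow> U' j = V' j"
  shows "row_sum n t y x c U U' k l = row_sum n t y x c V V' k l"
  unfolding row_sum_def by (rule path_sum_cong) (use assms in auto)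

definition top_state :: "nat \<Rightarrow> (nat \<Rightarrow> nat) \<Rightarrow> nat \<Rightarrow> nat set" where
  "top_state n s = (\<lambda>j\<in>{1..n}. {s j})"

definition bottom_state :: "nat \<Rightarrow> nat \<Rightarrow> nat set" where
  "bottom_state n = (\<lambda>j\<in>{1..n}. {})"

lemma partition_fun_eq_path_sum:
  assumes n: "0 < n" and s: "s ` {1..n} \<subseteq> {1..n}" and w: "w ` {1..n} \<subseteq> {1..n}"
  shows "partition_fun n t s w x y =
    path_sum ({1..n} \<rightarrow>\<^sub>E Pow {1..n}) (\<lambda>i U U'. row_sum n t y (x i) (Some (w i)) U U' n None)
      (top_state n s) n (bottom_state n)"
proof -
  let ?S = "insert None (Some ` {1..n})" and ?V = "{1..n} \<rightarrow>\<^sub>E Pow {1..n}"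
  let ?c = "with_ends (top_state n s) (bottom_state n) n"
  have rows: "(\<Sum>h\<in>{1..n} \<times> {1..<n} \<rightarrow>\<^sub>E ?S. \<Prod>i=1..n. \<Prod>j=1..n.
      weight t (x i) (y j) (hspin n w h i j) (A i j) (hspin n w h i (j - 1)) (B i j))
    = (\<Prod>i=1..n. row_sum n t y (x i) (Some (w i)) (A i) (B i) n None)" for A B
  proof -
    let ?P = "\<lambda>i g. \<Prod>j=1..n. weight t (x i) (y j) (with_ends (Some (w i)) None n g j) (A i j)
        (with_ends (Some (w i)) None n g (j - 1)) (B i j)"
    have "(\<Sum>h\<in>{1..n} \<times> {1..<n} \<rightarrow>\<^sub>E ?S. \<Prod>i=1..n. \<Prod>j=1..n.
        weight t (x i) (y j) (hspin n w h i j) (A i j) (hspin n w h i (j - 1)) (B i j))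
      = (\<Sum>h\<in>{1..n} \<times> {1..<n} \<rightarrow>\<^sub>E ?S. \<Prod>i=1..n. ?P i ((\<lambda>i\<in>{1..n}. \<lambda>j\<in>{1..<n}. h (i, j)) i))"
      by (intro sum.cong prod.cong refl) (auto simp: hspin_def with_ends_def)
    also have "\<dots> = (\<Sum>g\<in>{1..n} \<rightarrow>\<^sub>E ({1..<n} \<rightarrow>\<^sub>E ?S). \<Prod>i=1..n. ?P i (g i))"
      by (rule sum_PiE_curry)
    also have "\<dots> = (\<Prod>i=1..n. \<Sum>g\<in>{1..<n} \<rightarrow>\<^sub>E ?S. ?P i g)"
      by (rule prod_sum_PiE[symmetric]) (auto intro: finite_PiE)
    also have "\<dots> = (\<Prod>i=1..n. row_sum n t y (x i) (Some (w i)) (A i) (B i) n None)"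
    proof (rule prod.cong[OF refl])
      fix i assume "i \<in> {1..n}"
      then have "Some (w i) \<in> ?S" using w by (auto simp: image_subset_iff)
      then show "(\<Sum>g\<in>{1..<n} \<rightarrow>\<^sub>E ?S. ?P i g) = row_sum n t y (x i) (Some (w i)) (A i) (B i) n None"
        unfolding row_sum_def using n by (subst sum_interior_eq_path_sum[symmetric]) auto
    qed
    finally show ?thesis .
  qed
  have "partition_fun n t s w x y = (\<Sum>u\<in>{1..<n} \<times> {1..n} \<rightarrow>\<^sub>E Pow {1..n}. \<Prod>i=1..n.
      row_sum n t y (x i) (Some (w i)) (vspin n s u (i - 1)) (vspin n s u i) n None)"
    unfolding partition_fun_def by (subst sum.swap) (simp only: rows)
  also have "\<dots> = (\<Sum>u\<in>{1..<n} \<times> {1..n} \<rightarrow>\<^sub>E Pow {1..n}. \<Prod>i=1..n.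
      row_sum n t y (x i) (Some (w i)) (?c (\<lambda>i\<in>{1..<n}. \<lambda>j\<in>{1..n}. u (i, j)) (i - 1))
        (?c (\<lambda>i\<in>{1..<n}. \<lambda>j\<in>{1..n}. u (i, j)) i) n None)"
    by (intro sum.cong prod.cong refl row_sum_cong)
       (auto simp: vspin_def with_ends_def top_state_def bottom_state_def)
  also have "\<dots> = (\<Sum>u\<in>{1..<n} \<rightarrow>\<^sub>E ?V. \<Prod>i=1..n.
      row_sum n t y (x i) (Some (w i)) (?c u (i - 1)) (?c u i) n None)"
    by (rule sum_PiE_curry)
  also have "\<dots> = path_sum ?V (\<lambda>i U U'. row_sum n t y (x i) (Some (w i)) U U' n None)
      (top_state n s) n (bottom_state n)"
    using n s by (intro sum_interior_eq_path_sum finite_PiE) (auto simp: top_state_def)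
  finally show ?thesis .
qed

section \<open>The exchange relation for two rows\<close>

lemma sum_weight_eq_column_weight:
  assumes "finite K" "T \<subseteq> K" "set_option a \<subseteq> K"
  shows "(\<Sum>M\<in>Pow K. weight t x1 y a T c M * weight t x2 y b M d B)
    = column_weight t (x1 * inverse y) (x2 * inverse y) a b c d T B"
proof -
  have "bottom_spin a T c \<in> Pow K" using assms by (auto simp: bottom_spin_def)
  moreover have "(\<Sum>M\<in>Pow K. weight t x1 y a T c M * weight t x2 y b M d B)
    = (\<Sum>M\<in>Pow K. if M = bottom_spin a T c
        then column_weight t (x1 * inverse y) (x2 * inverse y) a b c d T B else 0)"
    by (rule sum.cong) (auto simp: weight_eq_vertex column_weight_def)
  ultimately show ?thesis using assms by simp
qed

definition two_row_sum :: "nat \<Rightarrow> 'a::field \<Rightarrow> (nat \<Rightarrow> 'a) \<Rightarrow> (nat \<Rightarrow> nat set) \<Rightarrow> (nat \<Rightarrow> nat set)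
    \<Rightarrow> 'a \<Rightarrow> 'a \<Rightarrow> nat option \<Rightarrow> nat option \<Rightarrow> nat \<Rightarrow> nat option \<Rightarrow> nat option \<Rightarrow> 'a" where
  "two_row_sum n t y U U'' x1 x2 c d k a b =
     path_sum (insert None (Some ` {1..n}) \<times> insert None (Some ` {1..n}))
       (\<lambda>j (c, d) (a, b). column_weight t (x1 * inverse (y j)) (x2 * inverse (y j)) a b c d (U j) (U'' j))
       (c, d) k (a, b)"

lemma row_sum_Suc:
  "row_sum n t y x c U U' (Suc k) l = (\<Sum>m\<in>insert None (Some ` {1..n}).
     row_sum n t y x c U U' k m * weight t x (y (Suc k)) l (U (Suc k)) m (U' (Suc k)))"
  by (simp only: row_sum_def path_sum.simps)

lemma two_row_sum_Suc:
  "two_row_sum n t y U U'' x1 x2 c d (Suc k) a b =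
    (\<Sum>m1\<in>insert None (Some ` {1..n}). \<Sum>m2\<in>insert None (Some ` {1..n}).
      two_row_sum n t y U U'' x1 x2 c d k m1 m2
      * column_weight t (x1 * inverse (y (Suc k))) (x2 * inverse (y (Suc k))) a b m1 m2 (U (Suc k)) (U'' (Suc k)))"
  by (simp only: two_row_sum_def path_sum.simps sum.cartesian_product split_def fst_conv snd_conv prod.collapse)

text \<open>
  The spin on the vertical edge between the two rows in a given column occurs only in the two
  vertices of that column, so the sum over these spins can be carried out column by column.
\<close>

lemma sum_row_sum_eq_two_row_sum:
  assumes "k \<le> n" "\<And>j. j \<in> {1..k} \<Longrightarrow> U j \<subseteq> {1..n}"
    and "a \<in> insert None (Some ` {1..n})"
  shows "(\<Sum>U'\<in>{1..k} \<rightarrow>\<^sub>E Pow {1..n}. row_sum n t y x1 c U U' k a * row_sum n t y x2 d U' U'' k b)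
    = two_row_sum n t y U U'' x1 x2 c d k a b"
  using assms
proof (induction k arbitrary: a b)
  case 0
  then show ?case by (simp add: row_sum_def two_row_sum_def)
next
  case (Suc k)
  let ?S = "insert None (Some ` {1..n})" and ?P = "Pow {1..n}"
  have up: "row_sum n t y x1 c U (h(Suc k := M)) k m = row_sum n t y x1 c U h k m"
    "row_sum n t y x2 d (h(Suc k := M)) U'' k m = row_sum n t y x2 d h U'' k m" for h M m
    by (rule row_sum_cong; simp)+
  have R1: "row_sum n t y x1 c U (h(Suc k := M)) (Suc k) a =
    (\<Sum>m\<in>?S. row_sum n t y x1 c U h k m * weight t x1 (y (Suc k)) a (U (Suc k)) m M)" for h M
    by (simp only: row_sum_Suc up fun_upd_same)
  have R2: "row_sum n t y x2 d (h(Suc k := M)) U'' (Suc k) b =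
    (\<Sum>m\<in>?S. row_sum n t y x2 d h U'' k m * weight t x2 (y (Suc k)) b M m (U'' (Suc k)))" for h M
    by (simp only: row_sum_Suc up fun_upd_same)
  have "{1..Suc k} = insert (Suc k) {1..k}" by auto
  then have "(\<Sum>U'\<in>{1..Suc k} \<rightarrow>\<^sub>E ?P.
      row_sum n t y x1 c U U' (Suc k) a * row_sum n t y x2 d U' U'' (Suc k) b)
    = (\<Sum>h\<in>{1..k} \<rightarrow>\<^sub>E ?P. \<Sum>M\<in>?P.
      row_sum n t y x1 c U (h(Suc k := M)) (Suc k) a
      * row_sum n t y x2 d (h(Suc k := M)) U'' (Suc k) b)"
    by (simp only:, subst sum_PiE_insert) simp_all
  also have "\<dots> = (\<Sum>h\<in>{1..k} \<rightarrow>\<^sub>E ?P. \<Sum>M\<in>?P. \<Sum>m1\<in>?S. \<Sum>m2\<in>?S.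
      (row_sum n t y x1 c U h k m1 * row_sum n t y x2 d h U'' k m2)
      * (weight t x1 (y (Suc k)) a (U (Suc k)) m1 M * weight t x2 (y (Suc k)) b M m2 (U'' (Suc k))))"
    unfolding R1 R2 by (simp only: sum_product mult_ac)
  also have "\<dots> = (\<Sum>m1\<in>?S. \<Sum>m2\<in>?S.
      (\<Sum>h\<in>{1..k} \<rightarrow>\<^sub>E ?P. row_sum n t y x1 c U h k m1 * row_sum n t y x2 d h U'' k m2)
      * (\<Sum>M\<in>?P. weight t x1 (y (Suc k)) a (U (Suc k)) m1 M * weight t x2 (y (Suc k)) b M m2 (U'' (Suc k))))"
    by (simp only: sum_product sum.swap[of _ ?P ?S] sum.swap[of _ "{1..k} \<rightarrow>\<^sub>E ?P" ?S] )
  also have "\<dots> = (\<Sum>m1\<in>?S. \<Sum>m2\<in>?S. two_row_sum n t y U U'' x1 x2 c d k m1 m2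
      * column_weight t (x1 * inverse (y (Suc k))) (x2 * inverse (y (Suc k))) a b m1 m2 (U (Suc k)) (U'' (Suc k)))"
    using Suc.prems by (intro sum.cong refl arg_cong2[where f = "(*)"] Suc.IH sum_weight_eq_column_weight) auto
  also have "\<dots> = two_row_sum n t y U U'' x1 x2 c d (Suc k) a b"
    by (simp only: two_row_sum_Suc)
  finally show ?case .
qed

text \<open>
  The R-matrix passes through the columns one at a time: each step uses the one-column
  equation at the new column and the induction hypothesis at the columns to its right.
\<close>

lemma two_row_sum_exchange:
  assumes "\<And>j. j \<in> {1..k} \<Longrightarrow> finite (U j)"
  shows "R_stay t x1 x2 a b * two_row_sum n t y U U'' x2 x1 c d k a b
      + R_swap t x1 x2 b a * two_row_sum n t y U U'' x2 x1 c d k b a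
    = two_row_sum n t y U U'' x1 x2 c d k a b * R_stay t x1 x2 c d
      + two_row_sum n t y U U'' x1 x2 d c k a b * R_swap t x1 x2 c d"
  using assms
proof (induction k arbitrary: a b)
  case 0
  then show ?case by (cases "a = c"; cases "b = d"; cases "a = d"; cases "b = c") (simp_all add: two_row_sum_def)
next
  case (Suc k)
  let ?S = "insert None (Some ` {1..n})"
  let ?G = "\<lambda>x1 x2. two_row_sum n t y U U'' x1 x2"
  let ?C = "\<lambda>x1 x2 a b c d. column_weight t (x1 * inverse (y (Suc k))) (x2 * inverse (y (Suc k))) a b c d (U (Suc k)) (U'' (Suc k))"
  let ?Rd = "R_stay t x1 x2" and ?Ro = "R_swap t x1 x2"
  have G: "?G x1 x2 c d (Suc k) a b = (\<Sum>m1\<in>?S. \<Sum>m2\<in>?S. ?G x1 x2 c d k m1 m2 * ?C x1 x2 a b m1 m2)"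
    for x1 x2 c d a b
    by (simp only: two_row_sum_Suc)
  have yb: "?Rd a b * ?C x2 x1 a b m1 m2 + ?Ro b a * ?C x2 x1 b a m1 m2
      = ?C x1 x2 a b m1 m2 * ?Rd m1 m2 + ?C x1 x2 a b m2 m1 * ?Ro m1 m2" for m1 m2
    using column_exchanges[of "U (Suc k)"] Suc.prems unfolding exchanges_def by auto
  have IH: "?Rd a b * ?G x2 x1 c d k a b + ?Ro b a * ?G x2 x1 c d k b a
      = ?G x1 x2 c d k a b * ?Rd c d + ?G x1 x2 d c k a b * ?Ro c d" for a b
    using Suc by auto
  have "?Rd a b * ?G x2 x1 c d (Suc k) a b + ?Ro b a * ?G x2 x1 c d (Suc k) b a
    = (\<Sum>m1\<in>?S. \<Sum>m2\<in>?S. ?G x2 x1 c d k m1 m2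
        * (?Rd a b * ?C x2 x1 a b m1 m2 + ?Ro b a * ?C x2 x1 b a m1 m2))"
    unfolding G by (simp only: sum_distrib_left sum.distrib[symmetric] distrib_left mult.left_commute)
  also have "\<dots> = (\<Sum>m1\<in>?S. \<Sum>m2\<in>?S. ?G x2 x1 c d k m1 m2 * ?C x1 x2 a b m1 m2 * ?Rd m1 m2)
      + (\<Sum>m1\<in>?S. \<Sum>m2\<in>?S. ?G x2 x1 c d k m1 m2 * ?C x1 x2 a b m2 m1 * ?Ro m1 m2)"
    unfolding yb by (simp only: sum.distrib[symmetric] distrib_left mult.assoc)
  \<comment> \<open>renaming the two spins in the second sum moves the R-matrix from the new column
    to the sum over the columns on its right\<close>
  also have "(\<Sum>m1\<in>?S. \<Sum>m2\<in>?S. ?G x2 x1 c d k m1 m2 * ?C x1 x2 a b m2 m1 * ?Ro m1 m2)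
      = (\<Sum>m1\<in>?S. \<Sum>m2\<in>?S. ?G x2 x1 c d k m2 m1 * ?C x1 x2 a b m1 m2 * ?Ro m2 m1)"
    by (rule sum.swap)
  also have "(\<Sum>m1\<in>?S. \<Sum>m2\<in>?S. ?G x2 x1 c d k m1 m2 * ?C x1 x2 a b m1 m2 * ?Rd m1 m2) + \<dots>
    = (\<Sum>m1\<in>?S. \<Sum>m2\<in>?S. ?C x1 x2 a b m1 m2
        * (?Rd m1 m2 * ?G x2 x1 c d k m1 m2 + ?Ro m2 m1 * ?G x2 x1 c d k m2 m1))"
    by (simp only: sum.distrib[symmetric] distrib_left mult_ac)
  also have "\<dots> = (\<Sum>m1\<in>?S. \<Sum>m2\<in>?S. ?C x1 x2 a b m1 m2
        * (?G x1 x2 c d k m1 m2 * ?Rd c d + ?G x1 x2 d c k m1 m2 * ?Ro c d))"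
    by (simp only: IH)
  also have "\<dots> = ?G x1 x2 c d (Suc k) a b * ?Rd c d + ?G x1 x2 d c (Suc k) a b * ?Ro c d"
    unfolding G by (simp only: sum_distrib_left sum_distrib_right sum.distrib distrib_left mult_ac)
  finally show ?case .
qed

text \<open>
  This carries a relation between the upper rows of three lattices over to the whole lattices, which
  agree in the rows below.
\<close>

lemma path_sum_linear:
  assumes "k \<le> n"
    and "\<And>j. k < j \<Longrightarrow> g j = f j" "\<And>j. k < j \<Longrightarrow> h j = f j"
    and "\<And>m. \<alpha> * path_sum S g a k m = \<beta> * path_sum S f a k m + \<gamma> * path_sum S h a k m"
  shows "\<alpha> * path_sum S g a n b = \<beta> * path_sum S f a n b + \<gamma> * path_sum S h a n b"
  using assms(1)
proof (induction n arbitrary: b rule: dec_induct)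
  case base
  then show ?case using assms(4) by simp
next
  case (step n)
  have "\<alpha> * path_sum S g a (Suc n) b = (\<Sum>m\<in>S. \<alpha> * path_sum S g a n m * f (Suc n) m b)"
    using step.hyps by (simp add: assms(2) sum_distrib_left mult.assoc)
  also have "\<dots> = \<beta> * path_sum S f a (Suc n) b + \<gamma> * path_sum S h a (Suc n) b"
    using step.hyps
    by (simp add: step.IH assms(3) sum_distrib_left mult.assoc distrib_right sum.distrib)
  finally show ?case .
qed

text \<open>
  Rows \<open>i\<close> and \<open>i + 1\<close> are exchanged. On the left both spins are uncolored, where the R-matrix is
  the scalar on the left-hand side.
\<close>

lemma partition_fun_exchange:
  fixes t :: "'a::field"
  assumes i: "i \<in> {1..<n}"
    and s: "s ` {1..n} \<subseteq> {1..n}" and w: "w ` {1..n} \<subseteq> {1..n}"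
  shows "(x i - t * x (i + 1)) * partition_fun n t s w (x \<circ> simple_refl i) y
    = R_stay t (x i) (x (i + 1)) (Some (w i)) (Some (w (i + 1))) * partition_fun n t s w x y
      + R_swap t (x i) (x (i + 1)) (Some (w i)) (Some (w (i + 1)))
        * partition_fun n t s (w \<circ> simple_refl i) x y"
proof -
  let ?V = "{1..n} \<rightarrow>\<^sub>E Pow {1..n::nat}"
  let ?f = "\<lambda>x w i U U'. row_sum n t y (x i) (Some (w i)) U U' n None"
  let ?x = "x \<circ> simple_refl i" and ?w = "w \<circ> simple_refl i"
  have n: "0 < n" using i by simp
  have w': "?w ` {1..n} \<subseteq> {1..n}"
    using w i by (auto simp: simple_refl_def transpose_def image_subset_iff)
  obtain k where k: "i = Suc k" using i by (cases i) auto
  have two: "path_sum ?V (?f x w) (top_state n s) (Suc i) b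
      = (\<Sum>m\<in>?V. path_sum ?V (?f x w) (top_state n s) k m
          * two_row_sum n t y m b (x i) (x (i + 1)) (Some (w i)) (Some (w (i + 1))) n None None)"
    for x w b
  proof -
    have "path_sum ?V (?f x w) (top_state n s) (Suc i) b
      = (\<Sum>m'\<in>?V. \<Sum>m\<in>?V. path_sum ?V (?f x w) (top_state n s) k m * (?f x w i m m' * ?f x w (Suc i) m' b))"
      by (simp add: k sum_distrib_right mult.assoc)
    also have "\<dots> = (\<Sum>m\<in>?V. path_sum ?V (?f x w) (top_state n s) k m
        * (\<Sum>m'\<in>?V. ?f x w i m m' * ?f x w (Suc i) m' b))"
      by (subst sum.swap) (simp only: sum_distrib_left)
    also have "\<dots> = (\<Sum>m\<in>?V. path_sum ?V (?f x w) (top_state n s) k m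
          * two_row_sum n t y m b (x i) (x (i + 1)) (Some (w i)) (Some (w (i + 1))) n None None)"
      by (intro sum.cong refl arg_cong2[where f = "(*)"], subst sum_row_sum_eq_two_row_sum) auto
    finally show ?thesis .
  qed
  have same: "path_sum ?V (?f ?x w) (top_state n s) k m = path_sum ?V (?f x w) (top_state n s) k m"
    "path_sum ?V (?f x ?w) (top_state n s) k m = path_sum ?V (?f x w) (top_state n s) k m" for m
    by (rule path_sum_cong; auto simp: k simple_refl_def transpose_def)+
  have refl_i: "?x i = x (i + 1)" "?x (i + 1) = x i" "?w i = w (i + 1)" "?w (i + 1) = w i"
    by (simp_all add: simple_refl_def)
  let ?G = "\<lambda>x1 x2 c d m b. two_row_sum n t y m b x1 x2 c d n None None"
  let ?c = "Some (w i)" and ?d = "Some (w (i + 1))"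
  have ex: "(x i - t * x (i + 1)) * ?G (x (i + 1)) (x i) ?c ?d m b
    = R_stay t (x i) (x (i + 1)) ?c ?d * ?G (x i) (x (i + 1)) ?c ?d m b
      + R_swap t (x i) (x (i + 1)) ?c ?d * ?G (x i) (x (i + 1)) ?d ?c m b" if "m \<in> ?V" for m b
  proof -
    have "finite (m j)" if "j \<in> {1..n}" for j
      using PiE_mem[OF \<open>m \<in> ?V\<close> that] by (auto intro: finite_subset)
    from two_row_sum_exchange[of n m t "x i" "x (i + 1)" None None n y b ?c ?d, OF this]
    show ?thesis by (simp add: R_stay_def R_swap_def mult.commute)
  qed
  have "(x i - t * x (i + 1)) * path_sum ?V (?f ?x w) (top_state n s) (Suc i) b
    = R_stay t (x i) (x (i + 1)) ?c ?d * path_sum ?V (?f x w) (top_state n s) (Suc i) b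
      + R_swap t (x i) (x (i + 1)) ?c ?d * path_sum ?V (?f x ?w) (top_state n s) (Suc i) b" for b
  proof -
    have "(x i - t * x (i + 1)) * path_sum ?V (?f ?x w) (top_state n s) (Suc i) b
      = (\<Sum>m\<in>?V. path_sum ?V (?f x w) (top_state n s) k m
          * ((x i - t * x (i + 1)) * ?G (x (i + 1)) (x i) ?c ?d m b))"
      unfolding two same refl_i by (simp only: sum_distrib_left mult.left_commute)
    also have "\<dots> = (\<Sum>m\<in>?V. path_sum ?V (?f x w) (top_state n s) k m
          * (R_stay t (x i) (x (i + 1)) ?c ?d * ?G (x i) (x (i + 1)) ?c ?d m b
            + R_swap t (x i) (x (i + 1)) ?c ?d * ?G (x i) (x (i + 1)) ?d ?c m b))"
      by (intro sum.cong refl) (simp only: ex)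
    also have "\<dots> = R_stay t (x i) (x (i + 1)) ?c ?d * path_sum ?V (?f x w) (top_state n s) (Suc i) b
      + R_swap t (x i) (x (i + 1)) ?c ?d * path_sum ?V (?f x ?w) (top_state n s) (Suc i) b"
      unfolding two same refl_i
      by (simp only: sum_distrib_left sum.distrib distrib_left mult.left_commute)
    finally show ?thesis .
  qed
  note at_Suc_i = this
  have "?x j = x j" "?w j = w j" if "Suc i < j" for j
    using that by (simp_all add: simple_refl_def transpose_def)
  then have later: "?f ?x w j = ?f x w j" "?f x ?w j = ?f x w j" if "Suc i < j" for j
    using that by simp_all
  show ?thesis
    unfolding partition_fun_eq_path_sum[OF n s w] partition_fun_eq_path_sum[OF n s w']
    by (rule path_sum_linear[OF _ later at_Suc_i]) (use i in simp)
qed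

section \<open>Length and descents of permutations\<close>

definition inversions :: "nat \<Rightarrow> (nat \<Rightarrow> nat) \<Rightarrow> (nat \<times> nat) set" where
  "inversions n w = {(i, j). 1 \<le> i \<and> i < j \<and> j \<le> n \<and> w j < w i}"

lemma finite_inversions [simp]: "finite (inversions n w)"
  by (rule finite_subset[of _ "{1..n} \<times> {1..n}"]) (auto simp: inversions_def)

lemma simple_refl_permutes: "i \<in> {1..<n} \<Longrightarrow> simple_refl i permutes {1..n}"
  unfolding simple_refl_def by (rule permutes_swap_id) auto

lemma simple_refl_involution: "w \<circ> simple_refl i \<circ> simple_refl i = w"
  by (simp add: simple_refl_def o_assoc[symmetric])

text \<open>
  Composition with the simple reflection moves the positions of the old inversions
  and creates exactly one new inversion, at the positions \<open>i\<close> and \<open>i + 1\<close>.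
\<close>

lemma card_inversions_ascent:
  assumes "i \<in> {1..<n}" "w i < w (i + 1)"
  shows "card (inversions n (w \<circ> simple_refl i)) = Suc (card (inversions n w))"
proof -
  let ?s = "simple_refl i"
  let ?g = "\<lambda>(a, b). (?s a, ?s b)"
  have ss: "?s (?s a) = a" for a by (simp add: simple_refl_def)
  have ord: "?s a < ?s b \<and> 1 \<le> ?s a \<and> ?s b \<le> n" if "1 \<le> a" "a < b" "b \<le> n" "(a, b) \<noteq> (i, i + 1)" for a b
    using that assms(1) by (auto simp: simple_refl_def transpose_def)
  have "inversions n (w \<circ> ?s) = insert (i, i + 1) (?g ` inversions n w)"
  proof (rule set_eqI, rule iffI)
    fix z assume "z \<in> inversions n (w \<circ> ?s)"
    moreover obtain a b where z: "z = (a, b)" by (cases z)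
    ultimately have ab: "1 \<le> a" "a < b" "b \<le> n" "w (?s b) < w (?s a)" by (auto simp: inversions_def)
    show "z \<in> insert (i, i + 1) (?g ` inversions n w)"
    proof (cases "(a, b) = (i, i + 1)")
      case False
      with ab ord have "(?s a, ?s b) \<in> inversions n w" by (auto simp: inversions_def)
      moreover have "z = ?g (?s a, ?s b)" by (simp add: z ss)
      ultimately show ?thesis by blast
    qed (simp add: z)
  next
    fix z assume z: "z \<in> insert (i, i + 1) (?g ` inversions n w)"
    show "z \<in> inversions n (w \<circ> ?s)"
    proof (cases "z = (i, i + 1)")
      case True
      then show ?thesis using assms by (simp add: inversions_def simple_refl_def)
    next
      case False
      with z obtain a b where ab: "(a, b) \<in> inversions n w" "z = (?s a, ?s b)" by auto
      then have "(a, b) \<noteq> (i, i + 1)" using assms by (auto simp: inversions_def)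
      then show ?thesis using ab ord[of a b] by (auto simp: inversions_def ss)
    qed
  qed
  moreover have "(i, i + 1) \<notin> ?g ` inversions n w"
  proof
    assume "(i, i + 1) \<in> ?g ` inversions n w"
    then obtain a b where "a < b" "?s a = i" "?s b = i + 1" by (auto simp: inversions_def)
    then show False using ss[of a] ss[of b] by (auto simp: simple_refl_def)
  qed
  moreover have "inj_on ?g (inversions n w)"
    by (rule inj_on_inverseI[of _ ?g]) (auto simp: ss)
  ultimately show ?thesis by (simp add: card_image)
qed

lemma card_inversions_descent:
  assumes "i \<in> {1..<n}" "w (i + 1) < w i"
  shows "card (inversions n w) = Suc (card (inversions n (w \<circ> simple_refl i)))"
proof -
  have "(w \<circ> simple_refl i) i < (w \<circ> simple_refl i) (i + 1)"
    using assms(2) by (simp add: simple_refl_def)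
  from card_inversions_ascent[OF assms(1) this] show ?thesis by (simp only: simple_refl_involution)
qed

lemma permutes_neq_Suc: "w permutes S \<Longrightarrow> w (i + 1) \<noteq> w i" for i :: nat
  using inj_eq[OF permutes_inj, of w S "i + 1" i] by simp

lemma permutes_eq_id_if_no_descent:
  fixes w :: "nat \<Rightarrow> nat"
  assumes w: "w permutes {1..n}" and "\<And>i. i \<in> {1..<n} \<Longrightarrow> w i < w (i + 1)"
  shows "w = id"
proof (rule permutes_natset_ge[OF w], rule ballI)
  fix j assume "j \<in> {1..n}"
  then have "1 \<le> j" "j \<le> n" by auto
  then show "j \<le> w j"
  proof (induction j rule: dec_induct)
    case base
    then show ?case using permutes_in_image[OF w, of 1] by simp
  next
    case (step j)
    then show ?case using assms(2)[of j] by simp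
  qed
qed

definition word :: "nat list \<Rightarrow> nat \<Rightarrow> nat" where
  "word ks = foldr (\<circ>) (map simple_refl ks) id"

lemma word_Nil: "word [] = id"
  by (simp add: word_def)

lemma inversions_id: "inversions n id = {}"
  by (auto simp: inversions_def)

lemma word_snoc: "word (ks @ [i]) = word ks \<circ> simple_refl i"
  unfolding word_def by (induction ks) (simp_all add: o_assoc)

lemma word_inversions_le:
  assumes "set ks \<subseteq> {1..<n}"
  shows "word ks permutes {1..n} \<and> card (inversions n (word ks)) \<le> length ks"
  using assms
proof (induction ks rule: rev_induct)
  case Nil
  show ?case unfolding word_Nil inversions_id by (intro conjI permutes_id) simp
next
  case (snoc i ks)
  let ?w = "word ks"
  have i: "i \<in> {1..<n}" and IH: "?w permutes {1..n}" "card (inversions n ?w) \<le> length ks"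
    using snoc by auto
  have "card (inversions n (?w \<circ> simple_refl i)) \<le> Suc (length ks)"
    using permutes_neq_Suc[OF IH(1), of i] card_inversions_ascent[OF i, of ?w] card_inversions_descent[OF i, of ?w] IH(2)
    by (cases "?w i < ?w (i + 1)") auto
  with permutes_compose[OF simple_refl_permutes[OF i] IH(1)] show ?case
    by (simp only: word_snoc length_append_singleton simp_thms)
qed

text \<open>
  Sorting by adjacent transpositions: every descent that is removed lowers the number of
  inversions by one.
\<close>

lemma exists_reduced_word:
  assumes "w permutes {1..n}"
  shows "\<exists>ks. length ks = card (inversions n w) \<and> set ks \<subseteq> {1..<n} \<and> w = word ks"
  using assms
proof (induction "card (inversions n w)" arbitrary: w rule: less_induct)
  case less
  show ?case
  proof (cases "w = id")
    case True
    show ?thesis unfolding True inversions_id by (intro exI[of _ "[]"]) (simp add: word_Nil)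
  next
    case False
    then obtain i where i: "i \<in> {1..<n}" "\<not> w i < w (i + 1)"
      using permutes_eq_id_if_no_descent[OF less.prems] by blast
    then have d: "w (i + 1) < w i" using permutes_neq_Suc[OF less.prems, of i] by simp
    note inv = card_inversions_descent[OF i(1) d]
    obtain ks where "length ks = card (inversions n (w \<circ> simple_refl i))" "set ks \<subseteq> {1..<n}"
      "w \<circ> simple_refl i = word ks"
      using less.hyps[OF _ permutes_compose[OF simple_refl_permutes[OF i(1)] less.prems]] inv by auto
    note ks = this
    have "w = word (ks @ [i])"
      by (simp only: word_snoc ks(3)[symmetric] simple_refl_involution)
    moreover have "length (ks @ [i]) = card (inversions n w)"
      unfolding inv by (simp add: ks(1))
    moreover have "set (ks @ [i]) \<subseteq> {1..<n}"
      using ks(2) i(1) by simp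
    ultimately show ?thesis by blast
  qed
qed

lemma perm_length_eq_inversions:
  assumes "w permutes {1..n}"
  shows "perm_length n w = card (inversions n w)"
  unfolding perm_length_def word_def[symmetric]
proof (rule Least_equality)
  show "\<exists>ks. length ks = card (inversions n w) \<and> set ks \<subseteq> {1..<n} \<and> w = word ks"
    by (rule exists_reduced_word[OF assms])
next
  fix k assume "\<exists>ks. length ks = k \<and> set ks \<subseteq> {1..<n} \<and> w = word ks"
  then show "card (inversions n w) \<le> k" using word_inversions_le by auto
qed

lemma perm_length_ascent:
  assumes "w permutes {1..n}" "i \<in> {1..<n}" "w i < w (i + 1)"
  shows "perm_length n (w \<circ> simple_refl i) = Suc (perm_length n w)"
  using card_inversions_ascent[of i n w] assms permutes_compose[OF simple_refl_permutes[OF assms(2)] assms(1)]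
  by (simp add: perm_length_eq_inversions)

lemma perm_length_descent:
  assumes "w permutes {1..n}" "i \<in> {1..<n}" "w (i + 1) < w i"
  shows "perm_length n w = Suc (perm_length n (w \<circ> simple_refl i))"
  using card_inversions_descent[of i n w] assms permutes_compose[OF simple_refl_permutes[OF assms(2)] assms(1)]
  by (simp add: perm_length_eq_inversions)

lemma bruhat_less_length: "bruhat_less n u w \<Longrightarrow> perm_length n u < perm_length n w"
  unfolding bruhat_less_def by (induction rule: tranclp_induct) (auto simp: bruhat_step_def)

text \<open>
  For elements that differ by a simple reflection on the right, the Bruhat order only sees
  whether the position \<open>i\<close> is an ascent, because it is compatible with the length.
\<close>

lemma bruhat_less_right_refl_iff:
  assumes "w permutes {1..n}" "i \<in> {1..<n}"
  shows "bruhat_less n w (w \<circ> simple_refl i) \<longleftrightarrow> w i < w (i + 1)"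
proof
  assume "bruhat_less n w (w \<circ> simple_refl i)"
  then show "w i < w (i + 1)"
    using bruhat_less_length[of n w "w \<circ> simple_refl i"] perm_length_descent[OF assms]
      permutes_neq_Suc[OF assms(1), of i]
    by (cases "w i < w (i + 1)") auto
next
  assume "w i < w (i + 1)"
  then have "bruhat_step n w (w \<circ> simple_refl i)"
    using perm_length_ascent[OF assms] assms(2) unfolding bruhat_step_def
    by (intro conjI exI[of _ i] exI[of _ "i + 1"]) (simp_all add: simple_refl_def)
  then show "bruhat_less n w (w \<circ> simple_refl i)"
    unfolding bruhat_less_def by (intro tranclp.r_into_trancl)
qed

lemma bruhat_less_left_refl_iff:
  assumes "w permutes {1..n}" "i \<in> {1..<n}"
  shows "bruhat_less n (w \<circ> simple_refl i) w \<longleftrightarrow> w (i + 1) < w i"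
  using bruhat_less_right_refl_iff[OF permutes_compose[OF simple_refl_permutes[OF assms(2)] assms(1)] assms(2)]
  unfolding simple_refl_involution by (simp add: simple_refl_def)

lemma longest_permutes: "longest n permutes {1..n}"
proof (rule bij_imp_permutes)
  show "bij_betw (longest n) {1..n} {1..n}"
    by (rule bij_betw_byWitness[where f' = "longest n"]) (auto simp: longest_def)
qed (auto simp: longest_def)

lemma permutes_eq_longest_if_no_ascent:
  fixes w :: "nat \<Rightarrow> nat"
  assumes w: "w permutes {1..n}" and "\<And>i. i \<in> {1..<n} \<Longrightarrow> w (i + 1) < w i"
  shows "w = longest n"
proof -
  have "longest n \<circ> w = id"
  proof (rule permutes_eq_id_if_no_descent[OF permutes_compose[OF w longest_permutes]])
    fix i assume i: "i \<in> {1..<n}"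
    then have "w i \<in> {1..n}" "w (i + 1) \<in> {1..n}" using permutes_in_image[OF w] by auto
    with assms(2)[OF i] show "(longest n \<circ> w) i < (longest n \<circ> w) (i + 1)"
      by (auto simp: longest_def)
  qed
  then have inv: "longest n (w j) = j" for j by (simp add: fun_eq_iff)
  show ?thesis
  proof
    fix j
    have "w j = longest n (longest n (w j))" by (auto simp: longest_def)
    then show "w j = longest n j" by (simp only: inv)
  qed
qed

lemma perm_length_longest: "perm_length n (longest n) = (\<Sum>i=1..n. n - i)"
proof -
  have "inversions n (longest n) = (SIGMA i:{1..n}. {i<..n})"
    by (auto simp: inversions_def longest_def)
  then show ?thesis by (simp add: perm_length_eq_inversions[OF longest_permutes] card_SigmaI)
qed

lemma perm_length_le_longest:
  assumes "w permutes {1..n}"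
  shows "perm_length n w \<le> perm_length n (longest n)"
  unfolding perm_length_eq_inversions[OF assms] perm_length_eq_inversions[OF longest_permutes]
  by (rule card_mono[OF finite_inversions]) (auto simp: inversions_def longest_def)

lemma permutes_induct_up [consumes 1, case_names id ascent]:
  assumes "w permutes {1..n}"
    and "P id"
    and "\<And>w i. w permutes {1..n} \<Longrightarrow> i \<in> {1..<n} \<Longrightarrow> w i < w (i + 1) \<Longrightarrow> P w \<Longrightarrow> P (w \<circ> simple_refl i)"
  shows "P w"
  using assms(1)
proof (induction "perm_length n w" arbitrary: w rule: less_induct)
  case less
  show ?case
  proof (cases "w = id")
    case False
    then obtain i where i: "i \<in> {1..<n}" "\<not> w i < w (i + 1)"
      using permutes_eq_id_if_no_descent[OF less.prems] by blast
    then have d: "w (i + 1) < w i" using permutes_neq_Suc[OF less.prems, of i] by simp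
    let ?u = "w \<circ> simple_refl i"
    have u: "?u permutes {1..n}" using permutes_compose[OF simple_refl_permutes[OF i(1)] less.prems] .
    have "P ?u" using less.hyps[OF _ u] perm_length_descent[OF less.prems i(1) d] by simp
    moreover have "?u i < ?u (i + 1)" using d by (simp add: simple_refl_def)
    ultimately have "P (?u \<circ> simple_refl i)" using assms(3)[OF u i(1)] by blast
    then show ?thesis by (simp only: simple_refl_involution)
  qed (simp add: assms(2))
qed

lemma permutes_induct_down [consumes 1, case_names longest descent]:
  assumes "w permutes {1..n}"
    and "P (longest n)"
    and "\<And>w i. w permutes {1..n} \<Longrightarrow> i \<in> {1..<n} \<Longrightarrow> w (i + 1) < w i \<Longrightarrow> P w \<Longrightarrow> P (w \<circ> simple_refl i)"
  shows "P w"
  using assms(1)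
proof (induction "perm_length n (longest n) - perm_length n w" arbitrary: w rule: less_induct)
  case less
  show ?case
  proof (cases "w = longest n")
    case False
    then obtain i where i: "i \<in> {1..<n}" "\<not> w (i + 1) < w i"
      using permutes_eq_longest_if_no_ascent[OF less.prems] by blast
    then have d: "w i < w (i + 1)" using permutes_neq_Suc[OF less.prems, of i] by simp
    let ?u = "w \<circ> simple_refl i"
    have u: "?u permutes {1..n}" using permutes_compose[OF simple_refl_permutes[OF i(1)] less.prems] .
    have "P ?u" using less.hyps[OF _ u] perm_length_ascent[OF less.prems i(1) d] perm_length_le_longest[OF u] by simp
    moreover have "?u (i + 1) < ?u i" using d by (simp add: simple_refl_def)
    ultimately have "P (?u \<circ> simple_refl i)" using assms(3)[OF u i(1)] by blast
    then show ?thesis by (simp only: simple_refl_involution)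
  qed (simp add: assms(2))
qed

section \<open>The frozen partition functions\<close>

lemma card_filter_singleton: "card {e. e = a \<and> P e} = (if P a then 1 else 0)"
proof -
  have "{e. e = a \<and> P e} = (if P a then {a} else {})" by auto
  then show ?thesis by simp
qed

text \<open>
  Read from the right, a row is forced as long as the vertical spins from above are single colors
  different from the color \<open>c\<close> that leaves on the right: no other spin can turn into \<open>c\<close> there, so \<open>c\<close>
  goes straight and the vertical colors do as well.
\<close>

lemma row_sum_before_source:
  assumes p: "j < p" and U: "\<And>i. i \<in> {1..<p} \<Longrightarrow> U i = {s i} \<and> s i \<noteq> c"
    and c: "c \<in> {1..n}"
  shows "row_sum n t y x (Some c) U U' j l
    = (if l = Some c \<and> (\<forall>i\<in>{1..j}. U' i = {s i})
       then \<Prod>i=1..j. (if c < s i then t else 1) * (1 - x * inverse (y i)) else 0)"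
  using p
proof (induction j arbitrary: l)
  case 0
  then show ?case by (auto simp: row_sum_def)
next
  case (Suc j)
  have U: "U (Suc j) = {s (Suc j)}" "s (Suc j) \<noteq> c" "c \<noteq> s (Suc j)"
    using U[of "Suc j"] Suc.prems by auto
  have "row_sum n t y x (Some c) U U' (Suc j) l
    = (\<Sum>m\<in>insert None (Some ` {1..n}). if m = Some c
        then row_sum n t y x (Some c) U U' j (Some c) * weight t x (y (Suc j)) l {s (Suc j)} (Some c) (U' (Suc j))
        else 0)"
    unfolding row_sum_Suc U(1) by (rule sum.cong) (use Suc in auto)
  also have "\<dots> = row_sum n t y x (Some c) U U' j (Some c) * weight t x (y (Suc j)) l {s (Suc j)} (Some c) (U' (Suc j))"
    using c by (subst sum.delta) auto
  also have "weight t x (y (Suc j)) l {s (Suc j)} (Some c) (U' (Suc j))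
    = (if l = Some c \<and> U' (Suc j) = {s (Suc j)}
       then (if c < s (Suc j) then t else 1) * (1 - x * inverse (y (Suc j))) else 0)"
    using U by (cases l) (simp_all add: card_filter_singleton)
  also have "row_sum n t y x (Some c) U U' j (Some c) * \<dots>
    = (if l = Some c \<and> (\<forall>i\<in>{1..Suc j}. U' i = {s i})
       then \<Prod>i=1..Suc j. (if c < s i then t else 1) * (1 - x * inverse (y i)) else 0)"
    using Suc by (simp add: atLeastAtMostSuc_conv)
  finally show ?case .
qed

text \<open>
  In the column \<open>p\<close> where \<open>c\<close> comes from above it turns right. Farther to the left nothing
  enters from above, and nothing enters from the left boundary either, so these vertices are empty
  and have weight one.
\<close>

lemma row_sum_of_frozen_row:
  assumes p: "1 \<le> p" "p \<le> j" and U: "\<And>i. i \<in> {1..<p} \<Longrightarrow> U i = {s i} \<and> s i \<noteq> c"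
    and Up: "U p = {c}" and U0: "\<And>i. i \<in> {p<..j} \<Longrightarrow> U i = {}" and c: "c \<in> {1..n}"
  shows "row_sum n t y x (Some c) U U' j None
    = (if \<forall>i\<in>{1..j}. U' i = (if i < p then {s i} else {})
       then \<Prod>i=1..<p. (if c < s i then t else 1) * (1 - x * inverse (y i)) else 0)"
  using p(2) U0
proof (induction j rule: dec_induct)
  case base
  obtain q where q: "p = Suc q" using p by (cases p) auto
  have R: "row_sum n t y x (Some c) U U' q l = (if l = Some c \<and> (\<forall>i\<in>{1..q}. U' i = {s i})
       then \<Prod>i=1..q. (if c < s i then t else 1) * (1 - x * inverse (y i)) else 0)" for l
    by (rule row_sum_before_source[where p = p]) (use U q c in auto)
  have "row_sum n t y x (Some c) U U' (Suc q) None
    = (\<Sum>m\<in>insert None (Some ` {1..n}). if m = Some c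
        then row_sum n t y x (Some c) U U' q (Some c) * weight t x (y (Suc q)) None {c} (Some c) (U' (Suc q))
        else 0)"
    unfolding row_sum_Suc Up[unfolded q]
    by (rule sum.cong) (auto simp: R)
  also have "\<dots> = row_sum n t y x (Some c) U U' q (Some c) * weight t x (y (Suc q)) None {c} (Some c) (U' (Suc q))"
    using c by (subst sum.delta) auto
  also have "weight t x (y (Suc q)) None {c} (Some c) (U' (Suc q)) = (if U' (Suc q) = {} then 1 else 0)"
    by (simp add: card_filter_singleton)
  finally show ?case
    by (simp add: R q atLeastAtMostSuc_conv atLeastLessThanSuc_atLeastAtMost)
next
  case (step j)
  have "row_sum n t y x (Some c) U U' (Suc j) None
    = (\<Sum>m\<in>insert None (Some ` {1..n}). if m = None
        then row_sum n t y x (Some c) U U' j None * weight t x (y (Suc j)) None {} None (U' (Suc j))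
        else 0)"
    unfolding row_sum_Suc using step by (intro sum.cong) auto
  also have "\<dots> = row_sum n t y x (Some c) U U' j None * weight t x (y (Suc j)) None {} None (U' (Suc j))"
    by (subst sum.delta) auto
  finally show ?case
    using step by (simp add: atLeastAtMostSuc_conv)
qed

text \<open>
  After \<open>k\<close> rows the colors of the leftmost \<open>k\<close> columns have left through the right boundary, and
  the others are still in the columns where they started.
\<close>

lemma partition_fun_frozen:
  fixes t :: "'a::field"
  assumes s: "s permutes {1..n}"
  shows "partition_fun n t s (s \<circ> longest n) x y
    = (\<Prod>i=1..n. \<Prod>j=1..<n + 1 - i. (if s (n + 1 - i) < s j then t else 1) * (1 - x i * inverse (y j)))"
proof (cases "n = 0")
  case True
  then show ?thesis by (simp add: partition_fun_def)
next
  case False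
  then have n: "0 < n" by simp
  have s1: "s ` {1..n} \<subseteq> {1..n}" using permutes_image[OF s] by simp
  have w1: "(s \<circ> longest n) ` {1..n} \<subseteq> {1..n}"
    using permutes_in_image[OF s] by (force simp: longest_def)
  let ?V = "{1..n} \<rightarrow>\<^sub>E Pow {1..n::nat}"
  \<comment> \<open>the vertical spins below row \<open>k\<close>\<close>
  define U where "U k = (\<lambda>j\<in>{1..n}. if j \<le> n - k then {s j} else {})" for k
  let ?f = "\<lambda>i U U'. row_sum n t y (x i) (Some ((s \<circ> longest n) i)) U U' n None"
  let ?P = "\<lambda>i. \<Prod>j=1..<n + 1 - i. (if s (n + 1 - i) < s j then t else 1) * (1 - x i * inverse (y j))"
  have UV: "U k \<in> ?V" for k
    using permutes_in_image[OF s] by (auto simp: U_def)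
  have row: "?f (Suc k) (U k) U' = (if U' = U (Suc k) then ?P (Suc k) else 0)" if "k < n" "U' \<in> ?V" for k U'
  proof -
    have "s i \<noteq> s (n - k)" if "i \<in> {1..<n - k}" for i
      using permutes_inj[OF s] that by (auto dest: injD)
    moreover have "s (n - k) \<in> {1..n}"
      using permutes_in_image[OF s, of "n - k"] \<open>k < n\<close> by simp
    ultimately have "row_sum n t y (x (Suc k)) (Some (s (n - k))) (U k) U' n None
      = (if \<forall>i\<in>{1..n}. U' i = (if i < n - k then {s i} else {}) then ?P (Suc k) else 0)"
      using \<open>k < n\<close> by (subst row_sum_of_frozen_row[where p = "n - k" and s = s]) (auto simp: U_def)
    moreover have "(\<forall>i\<in>{1..n}. U' i = (if i < n - k then {s i} else {})) \<longleftrightarrow> U' = U (Suc k)"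
    proof
      assume "\<forall>i\<in>{1..n}. U' i = (if i < n - k then {s i} else {})"
      then show "U' = U (Suc k)"
        by (intro PiE_ext[OF \<open>U' \<in> ?V\<close> UV]) (auto simp: U_def)
    qed (use that in \<open>auto simp: U_def\<close>)
    ultimately show ?thesis using that by (simp add: longest_def)
  qed
  have "path_sum ?V ?f (top_state n s) k U' = (if U' = U k then \<Prod>i=1..k. ?P i else 0)" if "k \<le> n" "U' \<in> ?V" for k U'
    using that
  proof (induction k arbitrary: U')
    case 0
    have "top_state n s = U 0" by (auto simp: top_state_def U_def fun_eq_iff restrict_def)
    then show ?case by auto
  next
    case (Suc k)
    have "path_sum ?V ?f (top_state n s) (Suc k) U'
      = (\<Sum>m\<in>?V. if m = U k then (\<Prod>i=1..k. ?P i) * ?f (Suc k) m U' else 0)"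
      unfolding path_sum.simps by (rule sum.cong) (use Suc in auto)
    also have "\<dots> = (\<Prod>i=1..k. ?P i) * ?f (Suc k) (U k) U'"
      using UV by (subst sum.delta) (auto intro: finite_PiE)
    finally show ?case using Suc.prems row by simp
  qed
  from this[of n "bottom_state n"] show ?thesis
    unfolding partition_fun_eq_path_sum[OF n s1 w1]
    by (simp add: U_def bottom_state_def cong: restrict_cong)
qed

definition staircase :: "nat \<Rightarrow> (nat \<times> nat) set" where
  "staircase n = {(i, j). 1 \<le> i \<and> 1 \<le> j \<and> i + j \<le> n}"

lemma staircase_Sigma: "staircase n = (SIGMA i:{1..n}. {1..<n + 1 - i})"
  by (auto simp: staircase_def)

lemma prod_staircase: "(\<Prod>(i, j)\<in>staircase n. f i j) = (\<Prod>i=1..n. \<Prod>j=1..<n + 1 - i. f i j)"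
  unfolding staircase_Sigma by (simp add: prod.Sigma)

lemma prod_staircase_swap: "(\<Prod>(i, j)\<in>staircase n. f i j) = (\<Prod>(i, j)\<in>staircase n. f j i)"
  by (rule prod.reindex_bij_witness[of _ prod.swap prod.swap]) (auto simp: staircase_def)

lemma prod_staircase_power: "(\<Prod>(i, j)\<in>staircase n. f i) = (\<Prod>i=1..n. f i ^ (n - i))"
  by (simp add: prod_staircase)

lemma card_staircase: "card (staircase n) = perm_length n (longest n)"
  unfolding staircase_Sigma perm_length_longest by (simp add: card_SigmaI)

lemma longest_longest: "longest n (longest n i) = i"
  by (auto simp: longest_def)

lemma partition_fun_id_longest:
  "partition_fun n t id (longest n) x y = (\<Prod>(i, j)\<in>staircase n. 1 - x i * inverse (y j))"
proof -
  have "partition_fun n t id (longest n) x y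
    = (\<Prod>(i, j)\<in>staircase n. (if n + 1 - i < j then t else 1) * (1 - x i * inverse (y j)))"
    using partition_fun_frozen[of id n t x y] by (simp add: permutes_id prod_staircase)
  also have "\<dots> = (\<Prod>(i, j)\<in>staircase n. 1 - x i * inverse (y j))"
    by (rule prod.cong) (auto simp: staircase_def)
  finally show ?thesis .
qed

lemma partition_fun_longest_id:
  "partition_fun n t (longest n) id x y
    = t ^ perm_length n (longest n) * (\<Prod>(i, j)\<in>staircase n. 1 - x i * inverse (y j))"
proof -
  have "longest n \<circ> longest n = id" by (simp add: fun_eq_iff longest_longest)
  then have "partition_fun n t (longest n) id x y
    = (\<Prod>(i, j)\<in>staircase n. (if longest n (n + 1 - i) < longest n j then t else 1) * (1 - x i * inverse (y j)))"
    using partition_fun_frozen[OF longest_permutes, of n t x y] by (simp only: prod_staircase)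
  also have "\<dots> = (\<Prod>(i, j)\<in>staircase n. t * (1 - x i * inverse (y j)))"
    by (rule prod.cong) (auto simp: staircase_def longest_def)
  also have "\<dots> = t ^ perm_length n (longest n) * (\<Prod>(i, j)\<in>staircase n. 1 - x i * inverse (y j))"
    by (simp add: split_def prod.distrib card_staircase)
  finally show ?thesis .
qed

section \<open>Monomial prefactors\<close>

lemma prod_split_adjacent:
  fixes i n :: nat
  assumes "i \<in> {1..<n}"
  shows "prod f {1..n} = f i * (f (i + 1) * prod f ({1..n} - {i, i + 1}))"
proof -
  have "prod f {1..n} = f i * prod f ({1..n} - {i})"
    by (rule prod.remove) (use assms in auto)
  also have "prod f ({1..n} - {i}) = f (i + 1) * prod f ({1..n} - {i} - {i + 1})"
    by (rule prod.remove) (use assms in auto)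
  also have "{1..n} - {i} - {i + 1} = {1..n} - {i, i + 1}" by auto
  finally show ?thesis .
qed

lemma r_factor_eq:
  "r_factor n x y = (-1) ^ perm_length n (longest n) * (\<Prod>i=1..n. x i ^ (n - i)) / (\<Prod>i=1..n. y i ^ (n - i))"
proof -
  have "y i powi - int (n - i) = inverse (y i ^ (n - i))" for i
    by (simp only: power_int_minus power_int_of_nat)
  then have "(\<Prod>i=1..n. y i powi - int (n - i)) = inverse (\<Prod>i=1..n. y i ^ (n - i))"
    by (simp only: prod_inversef[symmetric] o_def)
  then show ?thesis
    by (simp only: r_factor_def prod.distrib divide_inverse mult.assoc)
qed

text \<open>
  Exchanging two adjacent variables in a monomial whose exponents at these variables differ by one
  multiplies it by their quotient or its inverse.
\<close>

lemma prod_power_swap: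
  fixes x :: "nat \<Rightarrow> 'a::comm_ring_1"
  assumes i: "i \<in> {1..<n}"
  shows "e i = Suc (e (i + 1)) \<Longrightarrow>
      (\<Prod>k=1..n. (x \<circ> simple_refl i) k ^ e k) * x i = (\<Prod>k=1..n. x k ^ e k) * x (i + 1)"
    and "e (i + 1) = Suc (e i) \<Longrightarrow>
      (\<Prod>k=1..n. (x \<circ> simple_refl i) k ^ e k) * x (i + 1) = (\<Prod>k=1..n. x k ^ e k) * x i"
proof -
  have rest: "(\<Prod>k\<in>{1..n} - {i, i + 1}. (x \<circ> simple_refl i) k ^ e k) = (\<Prod>k\<in>{1..n} - {i, i + 1}. x k ^ e k)"
    by (rule prod.cong) (auto simp: simple_refl_def transpose_def)
  have at: "(x \<circ> simple_refl i) i = x (i + 1)" "(x \<circ> simple_refl i) (i + 1) = x i"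
    by (simp_all add: simple_refl_def)
  note split = prod_split_adjacent[OF i, of "\<lambda>k. (x \<circ> simple_refl i) k ^ e k"]
    prod_split_adjacent[OF i, of "\<lambda>k. x k ^ e k"]
  show "(\<Prod>k=1..n. (x \<circ> simple_refl i) k ^ e k) * x i = (\<Prod>k=1..n. x k ^ e k) * x (i + 1)"
    if "e i = Suc (e (i + 1))"
    unfolding split rest at that by (simp only: power_Suc mult_ac)
  show "(\<Prod>k=1..n. (x \<circ> simple_refl i) k ^ e k) * x (i + 1) = (\<Prod>k=1..n. x k ^ e k) * x i"
    if "e (i + 1) = Suc (e i)"
    unfolding split rest at that by (simp only: power_Suc mult_ac)
qed

lemma r_factor_swap:
  assumes "i \<in> {1..<n}" "x i \<noteq> 0"
  shows "r_factor n (x \<circ> simple_refl i) y = r_factor n x y * (x (i + 1) / x i)"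
proof -
  have "n - i = Suc (n - (i + 1))" using assms(1) by auto
  from prod_power_swap(1)[OF assms(1), of "\<lambda>k. n - k" x, OF this]
  have "(\<Prod>k=1..n. (x \<circ> simple_refl i) k ^ (n - k)) = (\<Prod>k=1..n. x k ^ (n - k)) * x (i + 1) / x i"
    by (rule eq_divide_imp[OF assms(2)])
  then show ?thesis unfolding r_factor_eq by (simp only: divide_inverse mult_ac)
qed

lemma r_factor_longest_swap:
  assumes i: "i \<in> {1..<n}" "x (i + 1) \<noteq> 0"
  shows "r_factor n (x \<circ> simple_refl i \<circ> longest n) y = r_factor n (x \<circ> longest n) y * (x i / x (i + 1))"
proof -
  have inv: "longest n (longest n k) = k" for k by (auto simp: longest_def)
  have perm: "(\<Prod>k=1..n. (x \<circ> longest n) k ^ (n - k)) = (\<Prod>k=1..n. x k ^ (n - longest n k))" for x :: "nat \<Rightarrow> 'a"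
    by (subst prod.permute[OF longest_permutes]) (simp add: inv o_def)
  have "n - longest n (i + 1) = Suc (n - longest n i)"
    using i by (simp add: longest_def)
  from prod_power_swap(2)[OF i(1), of "\<lambda>k. n - longest n k" x, OF this]
  have "(\<Prod>k=1..n. (x \<circ> simple_refl i) k ^ (n - longest n k))
      = (\<Prod>k=1..n. x k ^ (n - longest n k)) * x i / x (i + 1)"
    by (rule eq_divide_imp[OF i(2)])
  then show ?thesis
    unfolding r_factor_eq perm by (simp only: divide_inverse mult_ac)
qed

text \<open>
  Each factor satisfies \<open>1 - x / y = - (x / y) * (1 - y / x)\<close>; the monomials \<open>x / y\<close> of the
  whole staircase, together with the signs, multiply to the prefactor \<open>r\<close>.
\<close>

lemma prod_staircase_inverse:
  fixes x y :: "nat \<Rightarrow> 'a::field"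
  assumes "\<And>i. i \<in> {1..n} \<Longrightarrow> x i \<noteq> 0" "\<And>i. i \<in> {1..n} \<Longrightarrow> y i \<noteq> 0"
  shows "r_factor n x y * (\<Prod>(i, j)\<in>staircase n. 1 - y j / x i) = (\<Prod>(i, j)\<in>staircase n. 1 - x i / y j)"
proof -
  have "(\<Prod>(i, j)\<in>staircase n. 1 - x i / y j)
    = (\<Prod>(i, j)\<in>staircase n. (- 1) * (x i / y j * (1 - y j / x i)))"
    using assms by (intro prod.cong) (auto simp: staircase_def field_simps)
  also have "\<dots> = (- 1) ^ card (staircase n) * ((\<Prod>(i, j)\<in>staircase n. x i) / (\<Prod>(i, j)\<in>staircase n. y j)
      * (\<Prod>(i, j)\<in>staircase n. 1 - y j / x i))"
    by (simp only: split_def prod.distrib prod_dividef prod_constant)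
  also have "(\<Prod>(i, j)\<in>staircase n. y j) = (\<Prod>(i, j)\<in>staircase n. y i)"
    by (rule prod_staircase_swap)
  finally show ?thesis
    by (simp add: prod_staircase_power card_staircase r_factor_eq)
qed

section \<open>Stable envelopes\<close>

text \<open>
  The exchange relation at inverted parameters \<open>1 / a\<close>, \<open>1 / b\<close>, solved for the term with reflected
  permutation. The factor \<open>b / a\<close> is the effect of the reflection on the monomial prefactor, and
  \<open>inverse v\<close> is the change of the power of \<open>v\<close> when the length grows by one.
\<close>

lemma M_plus_from_exchange:
  fixes a b v t Z0 Z1 Z2 :: "'a::field"
  assumes "a \<noteq> 0" "b \<noteq> 0" "a \<noteq> b" "v \<noteq> 0" "t = inverse (v\<^sup>2)"
    and ex: "(inverse a - t * inverse b) * Z2 = (1 - t) * inverse a * Z0 + - t * (inverse a - inverse b) * Z1"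
  shows "inverse v * Z1 = (v - inverse v) / (1 - a / b) * Z0
    - (inverse v * (a / b) - v) / (1 - inverse (a / b)) * (b / a * Z2)"
proof -
  have d: "b - a \<noteq> 0" "1 - a / b = (b - a) / b" "1 - inverse (a / b) = - ((b - a) / a)"
    using assms by (auto simp: field_simps)
  have "a * b * v\<^sup>2 * ((inverse a - t * inverse b) * Z2) = (v\<^sup>2 * b - a) * Z2"
    using assms(1-5) by (simp add: field_simps)
  moreover have "a * b * v\<^sup>2 * ((1 - t) * inverse a * Z0 + - t * (inverse a - inverse b) * Z1)
      = (v\<^sup>2 - 1) * b * Z0 - (b - a) * Z1"
    using assms(1-5) by (simp add: field_simps)
  ultimately have "(v\<^sup>2 * b - a) * Z2 = (v\<^sup>2 - 1) * b * Z0 - (b - a) * Z1"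
    unfolding ex by simp
  then have "(b - a) * Z1 = (v\<^sup>2 - 1) * b * Z0 - (v\<^sup>2 * b - a) * Z2"
    by (simp only: diff_eq_eq eq_diff_eq add.commute)
  then have Z1: "Z1 = ((v\<^sup>2 - 1) * b * Z0 - (v\<^sup>2 * b - a) * Z2) / (b - a)"
    using d(1) by (simp add: eq_divide_eq mult.commute)
  show ?thesis
    unfolding Z1 d(2,3) using assms(1-4) d(1)
    by (simp add: divide_simps power2_eq_square) (simp add: algebra_simps)
qed

text \<open>
  The analogue at a descent: the length drops, which gives the factor \<open>v\<close>, and the
  prefactor is multiplied by \<open>a / b\<close>.
\<close>

lemma M_minus_from_exchange:
  fixes a b v t Z0 Z1 Z2 :: "'a::field"
  assumes "a \<noteq> 0" "b \<noteq> 0" "a \<noteq> b" "v \<noteq> 0" "t = inverse (v\<^sup>2)"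
    and ex: "(inverse a - t * inverse b) * Z2 = (1 - t) * inverse b * Z0 + - (inverse a - inverse b) * Z1"
  shows "v * Z1 = (inverse v - v) / (1 - inverse (a / b)) * Z0
    + (inverse v - v * inverse (a / b)) / (1 - a / b) * (a / b * Z2)"
proof -
  have d: "b - a \<noteq> 0" "1 - a / b = (b - a) / b" "1 - inverse (a / b) = - ((b - a) / a)"
    using assms by (auto simp: field_simps)
  have "a * b * v\<^sup>2 * ((inverse a - t * inverse b) * Z2) = (v\<^sup>2 * b - a) * Z2"
    using assms(1-5) by (simp add: field_simps)
  moreover have "a * b * v\<^sup>2 * ((1 - t) * inverse b * Z0 + - (inverse a - inverse b) * Z1)
      = (v\<^sup>2 - 1) * a * Z0 - v\<^sup>2 * (b - a) * Z1"
    using assms(1-5) by (simp add: field_simps)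
  ultimately have "(v\<^sup>2 * b - a) * Z2 = (v\<^sup>2 - 1) * a * Z0 - v\<^sup>2 * (b - a) * Z1"
    unfolding ex by simp
  then have "v\<^sup>2 * (b - a) * Z1 = (v\<^sup>2 - 1) * a * Z0 - (v\<^sup>2 * b - a) * Z2"
    by (simp only: diff_eq_eq eq_diff_eq add.commute)
  then have Z1: "Z1 = ((v\<^sup>2 - 1) * a * Z0 - (v\<^sup>2 * b - a) * Z2) / (v\<^sup>2 * (b - a))"
    using d(1) assms(4) by (simp add: eq_divide_eq mult.commute)
  show ?thesis
    unfolding Z1 d(2,3) using assms(1-4) d(1)
    by (simp add: divide_simps power2_eq_square) (simp add: algebra_simps)
qed

lemma generic_adjacent:
  assumes "generic n x y" "i \<in> {1..<n}"
  shows "x i \<noteq> 0 \<and> x (i + 1) \<noteq> 0 \<and> x i \<noteq> x (i + 1)"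
proof -
  have "\<forall>k\<in>{1..n}. x k \<noteq> 0" "inj_on x {1..n}"
    using assms(1) by (simp_all add: generic_def)
  then show ?thesis
    using assms(2) inj_on_eq_iff[of x "{1..n}" i "i + 1"] by simp
qed

lemma generic_swap:
  assumes "generic n x y" "i \<in> {1..<n}"
  shows "generic n (x \<circ> simple_refl i) y"
proof -
  note p = simple_refl_permutes[OF assms(2)]
  have "inj_on (x \<circ> simple_refl i) {1..n}"
    using assms(1) permutes_image[OF p] permutes_inj_on[OF p] by (auto simp: generic_def intro!: comp_inj_on)
  then show ?thesis
    using assms(1) permutes_in_image[OF p] by (auto simp: generic_def)
qed

lemma power_int_Suc_diff:
  fixes v :: "'a::field"
  assumes "v \<noteq> 0"
  shows "v powi (m - int (Suc k)) = v powi (m - int k) * inverse v"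
proof -
  have "v powi (m - int (Suc k)) = v powi ((m - int k) + (- 1))" by (simp add: algebra_simps)
  also have "\<dots> = v powi (m - int k) * v powi (- 1)" using assms by (subst power_int_add) simp_all
  finally show ?thesis by simp
qed

lemma prod_strict_pairs_eq_staircase:
  "(\<Prod>(i, j) | 1 \<le> i \<and> i < j \<and> j \<le> n. f i j) = (\<Prod>(i, j)\<in>staircase n. f i (longest n j))"
  by (rule prod.reindex_bij_witness[of _ "\<lambda>(i, j). (i, longest n j)" "\<lambda>(i, j). (i, longest n j)"])
     (auto simp: staircase_def longest_def)

lemma perm_length_id: "perm_length n id = 0"
  by (simp add: perm_length_eq_inversions permutes_id inversions_id)

text \<open>
  Multiplying the exchange relation by the prefactors turns it into the recursion. In the initial
  value the power \<open>q ^ \<ell>(w\<^sub>0)\<close> cancels the factors \<open>t\<close> of the frozen state, one for each box of the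
  staircase.
\<close>

lemma is_stab_plus_partition_fun:
  fixes v t :: "'a::field"
  assumes v: "v \<noteq> 0" and t: "t = inverse (v\<^sup>2)"
  shows "is_stab_plus n v (\<lambda>w x y.
      v powi (2 * int (perm_length n (longest n)) - int (perm_length n w))
      * r_factor n x (y \<circ> longest n)
      * partition_fun n t (longest n) w (\<lambda>i. inverse (x i)) (\<lambda>i. inverse ((y \<circ> longest n) i)))"
    (is "is_stab_plus n v ?S")
  unfolding is_stab_plus_def
proof (intro conjI allI impI)
  fix x y :: "nat \<Rightarrow> 'a"
  assume g: "generic n x y"
  let ?l = "perm_length n (longest n)" and ?y = "y \<circ> longest n"
  have y: "?y i \<noteq> 0" if "i \<in> {1..n}" for i
    using g permutes_in_image[OF longest_permutes, of n i] that by (simp add: generic_def)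
  have "v powi (2 * int ?l) = (v\<^sup>2) ^ ?l"
    by (metis of_nat_mult of_nat_numeral power_int_of_nat power_mult)
  then have q: "v powi (2 * int ?l) * t ^ ?l = 1"
    using v by (simp add: t power_inverse)
  have "?S id x y = v powi (2 * int ?l) * t ^ ?l
      * (r_factor n x ?y * (\<Prod>(i, j)\<in>staircase n. 1 - inverse (x i) * inverse (inverse (?y j))))"
    unfolding partition_fun_longest_id perm_length_id by simp
  also have "\<dots> = r_factor n x ?y * (\<Prod>(i, j)\<in>staircase n. 1 - ?y j / x i)"
    unfolding q by (simp add: divide_inverse mult.commute)
  also have "\<dots> = (\<Prod>(i, j)\<in>staircase n. 1 - x i / ?y j)"
    by (rule prod_staircase_inverse) (use g y in \<open>auto simp: generic_def\<close>)
  also have "\<dots> = (\<Prod>(i, j) | 1 \<le> i \<and> i < j \<and> j \<le> n. 1 - x i / y j)"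
    unfolding prod_strict_pairs_eq_staircase by simp
  finally show "?S id x y = (\<Prod>(i, j) | 1 \<le> i \<and> i < j \<and> j \<le> n. 1 - x i / y j)" .
next
  fix w i and x y :: "nat \<Rightarrow> 'a"
  assume w: "w permutes {1..n}" and i: "i \<in> {1..<n}"
    and b: "bruhat_less n w (w \<circ> simple_refl i)" and g: "generic n x y"
  have asc: "w i < w (i + 1)" using b bruhat_less_right_refl_iff[OF w i] by simp
  have x: "x i \<noteq> 0" "x (i + 1) \<noteq> 0" "x i \<noteq> x (i + 1)"
    using generic_adjacent[OF g i] by auto
  let ?X = "\<lambda>k. inverse (x k)" and ?Y = "\<lambda>k. inverse ((y \<circ> longest n) k)"
  let ?Z = "partition_fun n t (longest n)"
  let ?c = "v powi (2 * int (perm_length n (longest n)) - int (perm_length n w))"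
  let ?r = "r_factor n x (y \<circ> longest n)"
  have X: "?X \<circ> simple_refl i = (\<lambda>k. inverse ((x \<circ> simple_refl i) k))"
    by (simp add: fun_eq_iff)
  have "w ` {1..n} \<subseteq> {1..n}" "longest n ` {1..n} \<subseteq> {1..n}"
    using permutes_image[OF w] permutes_image[OF longest_permutes] by simp_all
  from partition_fun_exchange[OF i this(2,1), of ?X t ?Y]
  have "(inverse (x i) - t * inverse (x (i + 1))) * ?Z w (?X \<circ> simple_refl i) ?Y
    = (1 - t) * inverse (x i) * ?Z w ?X ?Y
      + - t * (inverse (x i) - inverse (x (i + 1))) * ?Z (w \<circ> simple_refl i) ?X ?Y"
    using asc by (simp add: R_stay_def R_swap_def)
  from M_plus_from_exchange[OF x v t this]
  have E: "inverse v * ?Z (w \<circ> simple_refl i) ?X ?Y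
    = (v - inverse v) / (1 - root_mon i x) * ?Z w ?X ?Y
      - (inverse v * root_mon i x - v) / (1 - inverse (root_mon i x))
        * (x (i + 1) / x i * ?Z w (?X \<circ> simple_refl i) ?Y)"
    unfolding root_mon_def .
  have "?S (w \<circ> simple_refl i) x y = ?c * ?r * (inverse v * ?Z (w \<circ> simple_refl i) ?X ?Y)"
    by (simp only: perm_length_ascent[OF w i asc] power_int_Suc_diff[OF v] mult_ac)
  also have "\<dots> = (v - inverse v) / (1 - root_mon i x) * (?c * ?r * ?Z w ?X ?Y)
      - (inverse v * root_mon i x - v) / (1 - inverse (root_mon i x))
        * (?c * (?r * (x (i + 1) / x i)) * ?Z w (?X \<circ> simple_refl i) ?Y)"
    unfolding E by (simp only: right_diff_distrib mult_ac)
  also have "\<dots> = M_plus v i (?S w) x y"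
    by (simp only: M_plus_def r_factor_swap[of i n x, OF i x(1)] X)
  finally show "?S (w \<circ> simple_refl i) x y = M_plus v i (?S w) x y" .
qed

text \<open>
  The recursion is again the exchange relation times the prefactors. With the identity at the top
  boundary no color of the frozen state crosses a larger one, so there are no factors \<open>t\<close>, and the
  prefactor alone accounts for the power of \<open>v\<close> in the initial value.
\<close>

lemma is_stab_minus_partition_fun:
  fixes v t :: "'a::field"
  assumes v: "v \<noteq> 0" and t: "t = inverse (v\<^sup>2)"
  shows "is_stab_minus n v (\<lambda>w x y.
      (- 1) ^ perm_length n (longest n)
      * v powi (2 * int (perm_length n (longest n)) - int (perm_length n w))
      * r_factor n (x \<circ> longest n) y
      * partition_fun n t id w (\<lambda>i. inverse (x i)) (\<lambda>i. inverse (y i)))"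
    (is "is_stab_minus n v ?S")
  unfolding is_stab_minus_def
proof (intro conjI allI impI)
  fix x y :: "nat \<Rightarrow> 'a"
  assume g: "generic n x y"
  let ?l = "perm_length n (longest n)" and ?x = "x \<circ> longest n"
  have x: "(\<Prod>i=1..n. x i ^ (n - i)) \<noteq> 0"
    using g by (auto simp: generic_def)
  have "(s * a / m) * (s * m / b) = s * (s * a / b)" if "m \<noteq> 0" for s a b m :: 'a
    using that by simp
  from this[OF x] have r: "r_factor n ?x x * r_factor n x y = (- 1) ^ ?l * r_factor n ?x y"
    unfolding r_factor_eq .
  have "(\<Prod>(i, j) | 1 \<le> i \<and> 1 \<le> j \<and> i + j \<le> n. 1 - x i / y j)
      = (\<Prod>(i, j)\<in>staircase n. 1 - x i / y j)"
    by (simp add: staircase_def)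
  also have "\<dots> = r_factor n x y * (\<Prod>(i, j)\<in>staircase n. 1 - y j / x i)"
    by (rule prod_staircase_inverse[symmetric]) (use g in \<open>auto simp: generic_def\<close>)
  also have "(\<Prod>(i, j)\<in>staircase n. 1 - y j / x i)
      = partition_fun n t id (longest n) (\<lambda>i. inverse (x i)) (\<lambda>i. inverse (y i))"
    unfolding partition_fun_id_longest by (simp add: divide_inverse mult.commute)
  finally show "?S (longest n) x y = v ^ ?l * r_factor n ?x x
      * (\<Prod>(i, j) | 1 \<le> i \<and> 1 \<le> j \<and> i + j \<le> n. 1 - x i / y j)"
    using r by (simp add: power_int_of_nat mult_ac)
next
  fix w i and x y :: "nat \<Rightarrow> 'a"
  assume w: "w permutes {1..n}" and i: "i \<in> {1..<n}"
    and b: "bruhat_less n (w \<circ> simple_refl i) w" and g: "generic n x y"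
  have desc: "w (i + 1) < w i" using b bruhat_less_left_refl_iff[OF w i] by simp
  have x: "x i \<noteq> 0" "x (i + 1) \<noteq> 0" "x i \<noteq> x (i + 1)"
    using generic_adjacent[OF g i] by auto
  let ?X = "\<lambda>k. inverse (x k)" and ?Y = "\<lambda>k. inverse (y k)"
  let ?Z = "partition_fun n t id"
  let ?w = "w \<circ> simple_refl i"
  let ?c = "(- 1) ^ perm_length n (longest n)
      * v powi (2 * int (perm_length n (longest n)) - int (perm_length n w))"
  let ?r = "r_factor n (x \<circ> longest n) y"
  have X: "?X \<circ> simple_refl i = (\<lambda>k. inverse ((x \<circ> simple_refl i) k))"
    by (simp add: fun_eq_iff)
  have "w ` {1..n} \<subseteq> {1..n}" "id ` {1..n} \<subseteq> {1..n}"
    using permutes_image[OF w] by simp_all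
  from partition_fun_exchange[OF i this(2,1), of ?X t ?Y]
  have "(inverse (x i) - t * inverse (x (i + 1))) * ?Z w (?X \<circ> simple_refl i) ?Y
    = (1 - t) * inverse (x (i + 1)) * ?Z w ?X ?Y
      + - (inverse (x i) - inverse (x (i + 1))) * ?Z ?w ?X ?Y"
    using desc by (simp add: R_stay_def R_swap_def)
  from M_minus_from_exchange[OF x v t this]
  have E: "v * ?Z ?w ?X ?Y
    = (inverse v - v) / (1 - inverse (root_mon i x)) * ?Z w ?X ?Y
      + (inverse v - v * inverse (root_mon i x)) / (1 - root_mon i x)
        * (x i / x (i + 1) * ?Z w (?X \<circ> simple_refl i) ?Y)"
    unfolding root_mon_def .
  have "v powi (2 * int (perm_length n (longest n)) - int (perm_length n ?w))
      = v powi (2 * int (perm_length n (longest n)) - int (perm_length n w)) * v"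
    using v by (simp add: perm_length_descent[OF w i desc] power_int_Suc_diff[OF v] del: of_nat_Suc)
  then have "?S ?w x y = ?c * ?r * (v * ?Z ?w ?X ?Y)"
    by (simp only: mult_ac)
  also have "\<dots> = (inverse v - v) / (1 - inverse (root_mon i x)) * (?c * ?r * ?Z w ?X ?Y)
      + (inverse v - v * inverse (root_mon i x)) / (1 - root_mon i x)
        * (?c * (?r * (x i / x (i + 1))) * ?Z w (?X \<circ> simple_refl i) ?Y)"
    unfolding E by (simp only: distrib_left mult_ac)
  also have "\<dots> = M_minus v i (?S w) x y"
    by (simp only: M_minus_def r_factor_longest_swap[of i n x, OF i x(2)] X)
  finally show "?S ?w x y = M_minus v i (?S w) x y" .
qed

lemma is_stab_plus_unique:
  assumes S: "is_stab_plus n v S" and S': "is_stab_plus n v S'"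
    and "w permutes {1..n}" "generic n x y"
  shows "S w x y = S' w x y"
  using assms(3,4)
proof (induction w arbitrary: x rule: permutes_induct_up)
  case id
  have "S id x y = (\<Prod>(i, j) | 1 \<le> i \<and> i < j \<and> j \<le> n. 1 - x i / y j)"
    using S id unfolding is_stab_plus_def by blast
  moreover have "S' id x y = (\<Prod>(i, j) | 1 \<le> i \<and> i < j \<and> j \<le> n. 1 - x i / y j)"
    using S' id unfolding is_stab_plus_def by blast
  ultimately show ?case by (simp only:)
next
  case (ascent w i)
  have IH: "\<And>x. generic n x y \<Longrightarrow> S w x y = S' w x y" and g: "generic n x y"
    using ascent by blast+
  have "generic n (x \<circ> simple_refl i) y"
    using generic_swap[OF g] ascent by blast
  from IH[OF g] IH[OF this] have "M_plus v i (S w) x y = M_plus v i (S' w) x y"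
    by (simp only: M_plus_def)
  moreover have "bruhat_less n w (w \<circ> simple_refl i)"
    using ascent bruhat_less_right_refl_iff by blast
  ultimately show ?case
    using S S' ascent unfolding is_stab_plus_def by metis
qed

lemma is_stab_minus_unique:
  assumes S: "is_stab_minus n v S" and S': "is_stab_minus n v S'"
    and "w permutes {1..n}" "generic n x y"
  shows "S w x y = S' w x y"
  using assms(3,4)
proof (induction w arbitrary: x rule: permutes_induct_down)
  case longest
  then show ?case using S S' by (simp add: is_stab_minus_def)
next
  case (descent w i)
  have IH: "\<And>x. generic n x y \<Longrightarrow> S w x y = S' w x y" and g: "generic n x y"
    using descent by blast+
  have "generic n (x \<circ> simple_refl i) y"
    using generic_swap[OF g] descent by blast
  from IH[OF g] IH[OF this] have "M_minus v i (S w) x y = M_minus v i (S' w) x y"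
    by (simp only: M_minus_def)
  moreover have "bruhat_less n (w \<circ> simple_refl i) w"
    using descent bruhat_less_left_refl_iff by blast
  ultimately show ?case
    using S S' descent unfolding is_stab_minus_def by metis
qed

theorem theorem6p7:
  fixes n :: nat and v q t :: "'a::field" and x y :: "nat \<Rightarrow> 'a" and w :: "nat \<Rightarrow> nat"
  assumes "v \<noteq> 0" and "q = v ^ 2" and "t = inverse q"
    and "generic n x y"
    and "w permutes {1..n}"
  shows "stab_minus n v w x y =
           (-1) ^ perm_length n (longest n)
           * v powi (2 * int (perm_length n (longest n)) - int (perm_length n w))
           * r_factor n (x \<circ> longest n) y
           * partition_fun n t id w (\<lambda>i. inverse (x i)) (\<lambda>i. inverse (y i))
       \<and> stab_plus n v w x y =
           v powi (2 * int (perm_length n (longest n)) - int (perm_length n w))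
           * r_factor n x (y \<circ> longest n)
           * partition_fun n t (longest n) w (\<lambda>i. inverse (x i)) (\<lambda>i. inverse ((y \<circ> longest n) i))"
proof -
  have t: "t = inverse (v\<^sup>2)" using assms(2,3) by simp
  note minus = is_stab_minus_partition_fun[OF assms(1) t, of n]
  note plus = is_stab_plus_partition_fun[OF assms(1) t, of n]
  have "is_stab_minus n v (stab_minus n v)"
    unfolding stab_minus_def by (rule someI[of "is_stab_minus n v", OF minus])
  moreover have "is_stab_plus n v (stab_plus n v)"
    unfolding stab_plus_def by (rule someI[of "is_stab_plus n v", OF plus])
  ultimately show ?thesis
    using is_stab_minus_unique[OF _ minus assms(5,4)] is_stab_plus_unique[OF _ plus assms(5,4)]
    by simp
qed

end
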